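(* Let $m\ge2$, let $\rho:[0,1]\to[0,1]$ be continuous and nondecreasing with $x\in(0,1]\mapsto\rho(x)/x$ nondecreasing, and let $t_k=\rho(k/m)$. Let $\zeta\in(0,1)$, $\lambda\in\{1,\dots,m\}$ and $\delta\in(0,1)$. Define $G^{DU}_\zeta(x)=(1-\zeta)+\zeta x$, $$u^+_\delta=\mathcal{U}\big(\lambda/m,(G^{DU}_\zeta+\delta)\wedge 1\big),\qquad u^-_\delta=\mathcal{U}\big(\lambda/m,(G^{DU}_\zeta-\delta)\vee 0\big),$$ and for $y\in(0,1)$, $$\varepsilon(\delta,m,\zeta,y)=\frac{\rho(u^+_\delta)-\rho(u^-_\delta)}{u^+_\delta}+\frac{4}{1-\zeta}\exp\Big(-2m\big(\delta-y-\tfrac1m\big)_+^2\,(1-y/\zeta)_+\Big).$$ Then for every $F\in\mathcal F$: (i) in the fixed mixture model with $0<m_0<m$, setting $\nu=\max_{k\in\{m_0-1,m_0\}}|k/m-\zeta|$, $$\mathrm{FDR}(\mathrm{SUD}_\lambda(\mathbf t),\mathrm{FM}(m,m_0,F))\le \mathrm{FDR}(\mathrm{SUD}_\lambda(\mathbf t),\mathrm{FM}(m,m_0,F\equiv1))+\frac{m_0}{m}\,\varepsilon(\delta,m,\zeta,\nu);$$ (ii) in the random mixture model with $\pi_0=\zeta$, for every $\gamma\in(0,1)$, $$\mathrm{FDR}(\mathrm{SUD}_\lambda(\mathbf t),\mathrm{RM}(m,\pi_0,F))\le \mathrm{FDR}(\mathrm{SUD}_\lambda(\mathbf t),\mathr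m{RM}(m,\pi_0,F\equiv1))+\pi_0\,\varepsilon(\delta,m,\zeta,\gamma)+4e^{-2m(\gamma-1/m)_+^2}.$$
   Context: $\mathcal F$ is the set of continuous c.d.f.'s from $[0,1]$ to $[0,1]$. Fixed mixture model $\mathrm{FM}(m,m_0,F)$: $p_1,\dots,p_m$ are mutually independent, $p_i\sim U(0,1)$ for $1\le i\le m_0$ (true nulls), $p_i\sim F$ for $m_0<i\le m$. Random mixture model $\mathrm{RM}(m,\pi_0,F)$: $m_0\sim\mathrm{Binomial}(m,\pi_0)$ is unobserved and, conditionally on $m_0$, $\mathbf p\sim\mathrm{FM}(m,m_0,F)$. The case $F\equiv1$ (Dirac-uniform configuration) means the alternative $p$-values equal $0$ almost surely. Step-up-down procedure $\mathrm{SUD}_\lambda(\mathbf t)$ for a nondecreasing threshold collection $\mathbf t=(t_k)_{1\le k\le m}\subset[0,1]$, $t_0=0$: with $p_{(1)}\le\dots\le p_{(m)}$, $p_{(0)}=0$, let $\hat k=\max\{k\in\{\lambda,\dots,m\}: \forall k'\in\{\lambda,\dots,k\},\ p_{(k')}\le t_{k'}\}$ if $p_{(\lambda)}\le t_\lambda$, and $\hat k=\max\{k\in\{0,\dots,\lambda\}: p_{(k)}\le t_k\}$ otherwise; it rejects hypothesis $i$ iff $p_i\le t_{\hat k}$. FDR: $\mathrm{FDR}(\mathrm{SUD}_\lambda(\mathbf t),P)=\mathbb E_{\mathbf p\sim P}\Big[\frac{|\{1\le i\le m_0: p_i\le t_{\hat k}\}|}{|\{1\le i\le m: p_i\le t_{\hat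 k}\}|\vee1}\Big]$, where $m_0$ is random under RM and the expectation is also over $m_0$. For nondecreasing $G:[0,1]\to[0,1]$ and $\tau\in[0,1]$: $\mathcal{U}(\tau,G)=\min\{u\in[\tau,1]: G(\rho(u))\le u\}$ if $G(\rho(\tau))\ge\tau$, and $\mathcal{U}(\tau,G)=\max\{u\in[0,\tau]: G(\rho(u))\ge u\}$ if $G(\rho(\tau))<\tau$. *)

theory Defs
  imports "HOL-Probability.Probability"
begin

definition cdf_class :: "(real \<Rightarrow> real) set" where
  "cdf_class = {F. continuous_on {0..1} F \<and> mono_on {0..1} F \<and>
                   F ` {0..1} \<subseteq> {0..1} \<and> F 1 = 1}"

definition cdf_ext :: "(real \<Rightarrow> real) \<Rightarrow> real \<Rightarrow> real" where
  "cdf_ext F x = (if x < 0 then 0 else if x \<le> 1 then F x else 1)"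

text \<open>The probability law on the reals with c.d.f. F (supported on [0,1]).
  For F = id this is the uniform law U(0,1); for F = (\<lambda>_. 1) it is the Dirac mass at 0.\<close>
definition law :: "(real \<Rightarrow> real) \<Rightarrow> real measure" where
  "law F = interval_measure (cdf_ext F)"

text \<open>Fixed mixture model FM(m,m0,F): p-values indexed 0..m-1, the first m0 (indices < m0)
  are uniform (true nulls), the remaining ones have c.d.f. F; mutually independent.\<close>
definition FM :: "nat \<Rightarrow> nat \<Rightarrow> (real \<Rightarrow> real) \<Rightarrow> (nat \<Rightarrow> real) measure" where
  "FM m m0 F = PiM {..<m} (\<lambda>i. if i < m0 then law (\<lambda>x. x) else law F)"

definition ord_stat :: "nat \<Rightarrow> (nat \<Rightarrow> real) \<Rightarrow> nat \<Rightarrow> real" where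
  "ord_stat m p k = (if k = 0 then 0 else sort (map p [0..<m]) ! (k - 1))"

definition thr :: "(nat \<Rightarrow> real) \<Rightarrow> nat \<Rightarrow> real" where
  "thr t k = (if k = 0 then 0 else t k)"

definition sud_khat :: "nat \<Rightarrow> nat \<Rightarrow> (nat \<Rightarrow> real) \<Rightarrow> (nat \<Rightarrow> real) \<Rightarrow> nat" where
  "sud_khat m lam t p =
     (if ord_stat m p lam \<le> thr t lam
      then Max {k \<in> {lam..m}. \<forall>k'\<in>{lam..k}. ord_stat m p k' \<le> thr t k'}
      else Max {k \<in> {0..lam}. ord_stat m p k \<le> thr t k})"

definition FDP :: "nat \<Rightarrow> nat \<Rightarrow> nat \<Rightarrow> (nat \<Rightarrow> real) \<Rightarrow> (nat \<Rightarrow> real) \<Rightarrow> real" where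
  "FDP m m0 lam t p =
     (let c = thr t (sud_khat m lam t p) in
      real (card {i. i < m0 \<and> p i \<le> c}) / real (max (card {i. i < m \<and> p i \<le> c}) 1))"

definition FDR_FM :: "nat \<Rightarrow> nat \<Rightarrow> nat \<Rightarrow> (nat \<Rightarrow> real) \<Rightarrow> (real \<Rightarrow> real) \<Rightarrow> real" where
  "FDR_FM m m0 lam t F = (\<integral>p. FDP m m0 lam t p \<partial>FM m m0 F)"

text \<open>Random mixture model RM(m,pi0,F): m0 ~ Binomial(m,pi0), then FM(m,m0,F);
  the FDR is the expectation over m0 of the conditional FDR.\<close>
definition FDR_RM :: "nat \<Rightarrow> real \<Rightarrow> nat \<Rightarrow> (nat \<Rightarrow> real) \<Rightarrow> (real \<Rightarrow> real) \<Rightarrow> real" where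
  "FDR_RM m pi0 lam t F =
     (\<Sum>k\<le>m. real (m choose k) * pi0 ^ k * (1 - pi0) ^ (m - k) * FDR_FM m k lam t F)"

text \<open>The functional U(tau, G) (depending on rho).  The min/max of the paper are written
  as Inf/Sup; they coincide whenever the min/max exist.\<close>
definition U_fun :: "(real \<Rightarrow> real) \<Rightarrow> real \<Rightarrow> (real \<Rightarrow> real) \<Rightarrow> real" where
  "U_fun \<rho> \<tau> G =
     (if G (\<rho> \<tau>) \<ge> \<tau> then Inf {u \<in> {\<tau>..1}. G (\<rho> u) \<le> u}
      else Sup {u \<in> {0..\<tau>}. G (\<rho> u) \<ge> u})"

definition G_DU :: "real \<Rightarrow> real \<Rightarrow> real" where
  "G_DU \<zeta> x = (1 - \<zeta>) + \<zeta> * x"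

definition u_plus :: "(real \<Rightarrow> real) \<Rightarrow> nat \<Rightarrow> nat \<Rightarrow> real \<Rightarrow> real \<Rightarrow> real" where
  "u_plus \<rho> m lam \<zeta> \<delta> = U_fun \<rho> (real lam / real m) (\<lambda>x. min (G_DU \<zeta> x + \<delta>) 1)"

definition u_minus :: "(real \<Rightarrow> real) \<Rightarrow> nat \<Rightarrow> nat \<Rightarrow> real \<Rightarrow> real \<Rightarrow> real" where
  "u_minus \<rho> m lam \<zeta> \<delta> = U_fun \<rho> (real lam / real m) (\<lambda>x. max (G_DU \<zeta> x - \<delta>) 0)"

definition eps_bound :: "(real \<Rightarrow> real) \<Rightarrow> nat \<Rightarrow> real \<Rightarrow> nat \<Rightarrow> real \<Rightarrow> real \<Rightarrow> real" where
  "eps_bound \<rho> lam \<delta> m \<zeta> y =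
     (\<rho> (u_plus \<rho> m lam \<zeta> \<delta>) - \<rho> (u_minus \<rho> m lam \<zeta> \<delta>)) / u_plus \<rho> m lam \<zeta> \<delta>
     + 4 / (1 - \<zeta>) * exp (- 2 * real m * (max 0 (\<delta> - y - 1 / real m))\<^sup>2 * max 0 (1 - y / \<zeta>))"

end

theory Submission
  imports Defs "HOL-Probability.Hoeffding"
begin

text \<open>
  Fix a null index \<open>i\<close> and set all alternative p-values to \<open>0\<close>. Write \<open>K\<close> for the number of
  rejections, \<open>K'\<close> for its value when moreover \<open>p\<^sub>i = 0\<close>, and \<open>K''\<close> for its value when \<open>p\<^sub>i\<close> is never
  counted; \<open>K'\<close> and \<open>K''\<close> are independent of \<open>p\<^sub>i\<close>, and \<open>K'' \<le> K \<le> K'\<close>. If \<open>p\<^sub>i\<close> is rejected then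
  setting it to \<open>0\<close> changes nothing, so monotonicity of \<open>t\<^sub>k / k\<close> bounds the contribution of \<open>i\<close> to
  the FDR, for every \<open>F\<close>, by the expectation of \<open>1{p\<^sub>i \<le> t\<^sub>K\<^sub>'} / K'\<close>. This exceeds its contribution in
  the Dirac-uniform configuration only if \<open>K' \<ge> \<lambda>\<close> and \<open>t\<^sub>K\<^sub>'\<^sub>' < p\<^sub>i \<le> t\<^sub>K\<^sub>'\<close>, which costs at most
  \<open>(\<rho>(u\<^sup>+) - \<rho>(u\<^sup>-)) / (m u\<^sup>+)\<close> as long as \<open>K' \<le> m u\<^sup>+\<close> and \<open>m u\<^sup>- \<le> K''\<close>.

  Because of the restriction to \<open>K' \<ge> \<lambda>\<close>, the first of these two events can only fail through a
  deviation of the empirical c.d.f. at a single point, to which Hoeffding's inequality applies. The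
  second one needs a deviation below a linear boundary that is uniform over a finite set of points.
  No DKW inequality is needed for it: Ville's inequality for one likelihood ratio martingale gives the
  exponent \<open>2 n s\<^sup>2 / (1 + s)\<close>, and the lost factor \<open>1 + s\<close> is harmless since \<open>\<delta> \<le> 1 - \<zeta>\<close> whenever the
  event is not void.
\<close>

section \<open>Functions determined by finitely many threshold comparisons\<close>

definition determined_by :: "'i set \<Rightarrow> real set \<Rightarrow> (('i \<Rightarrow> real) \<Rightarrow> 'b) \<Rightarrow> bool" where
  "determined_by I X f \<longleftrightarrow>
     (\<forall>p q. (\<forall>i\<in>I. \<forall>x\<in>X. p i \<le> x \<longleftrightarrow> q i \<le> x) \<longrightarrow> f p = f q)"

lemma determined_byI:
  assumes "\<And>p q. (\<And>i x. i \<in> I \<Longrightarrow> x \<in> X \<Longrightarrow> p i \<le> x \<longleftrightarrow> q i \<le> x) \<Longrightarrow> f p = f q"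
  shows "determined_by I X f"
  unfolding determined_by_def using assms by blast

lemma determined_byD:
  assumes "determined_by I X f" "\<And>i x. i \<in> I \<Longrightarrow> x \<in> X \<Longrightarrow> p i \<le> x \<longleftrightarrow> q i \<le> x"
  shows "f p = f q"
  using assms unfolding determined_by_def by blast

lemma determined_by_mono:
  "determined_by I X f \<Longrightarrow> I \<subseteq> I' \<Longrightarrow> X \<subseteq> X' \<Longrightarrow> determined_by I' X' f"
  unfolding determined_by_def by (meson subsetD)

lemma determined_by_comp2:
  assumes "determined_by I X f" "determined_by I X g"
  shows "determined_by I X (\<lambda>p. h (f p) (g p))"
  using assms unfolding determined_by_def by metis

lemma determined_by_comp:
  "determined_by I X f \<Longrightarrow> determined_by I X (\<lambda>p. h (f p))"
  using determined_by_comp2[of I X f f "\<lambda>a b. h a"] by simp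

lemma determined_by_sum:
  "(\<And>a. a \<in> A \<Longrightarrow> determined_by I X (f a)) \<Longrightarrow> determined_by I X (\<lambda>p. \<Sum>a\<in>A. f a p)"
  unfolding determined_by_def by (intro allI impI sum.cong refl) blast

lemma determined_by_prod:
  "(\<And>a. a \<in> A \<Longrightarrow> determined_by I X (f a)) \<Longrightarrow> determined_by I X (\<lambda>p. \<Prod>a\<in>A. f a p)"
  unfolding determined_by_def by (intro allI impI prod.cong refl) blast

lemma determined_by_bex:
  "(\<And>a. a \<in> A \<Longrightarrow> determined_by I X (f a)) \<Longrightarrow> determined_by I X (\<lambda>p. \<exists>a\<in>A. f a p)"
  unfolding determined_by_def by (intro allI impI bex_cong refl) blast

lemma determined_by_card:
  assumes "J \<subseteq> I" "x \<in> X"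
  shows "determined_by I X (\<lambda>p. card {j \<in> J. p j \<le> x})"
proof (rule determined_byI)
  fix p q :: "'a \<Rightarrow> real"
  assume "\<And>i x. i \<in> I \<Longrightarrow> x \<in> X \<Longrightarrow> p i \<le> x \<longleftrightarrow> q i \<le> x"
  then have "{j \<in> J. p j \<le> x} = {j \<in> J. q j \<le> x}" using assms by blast
  then show "card {j \<in> J. p j \<le> x} = card {j \<in> J. q j \<le> x}" by simp
qed

lemma determined_by_restrict:
  "determined_by J X f \<Longrightarrow> f (restrict p J) = f p"
  by (erule determined_byD) simp

definition threshold_pattern :: "'i set \<Rightarrow> real set \<Rightarrow> ('i \<Rightarrow> real) \<Rightarrow> ('i \<times> real) set" where
  "threshold_pattern I X p = {z \<in> I \<times> X. p (fst z) \<le> snd z}"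

lemma determined_by_factor:
  assumes "determined_by I X f"
  shows "\<exists>g. f = g \<circ> threshold_pattern I X"
proof -
  have f: "f p = f q" if "threshold_pattern I X p = threshold_pattern I X q" for p q
    using assms
  proof (rule determined_byD)
    fix i x assume "i \<in> I" "x \<in> X"
    then have "(i, x) \<in> threshold_pattern I X p \<longleftrightarrow> p i \<le> x"
      "(i, x) \<in> threshold_pattern I X q \<longleftrightarrow> q i \<le> x"
      by (auto simp: threshold_pattern_def)
    with that show "p i \<le> x \<longleftrightarrow> q i \<le> x" by simp
  qed
  let ?g = "\<lambda>s. f (SOME q. threshold_pattern I X q = s)"
  have "f p = ?g (threshold_pattern I X p)" for p
    by (rule f, rule sym, rule someI[of "\<lambda>q. threshold_pattern I X q = threshold_pattern I X p" p]) (rule refl)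
  then have "f = ?g \<circ> threshold_pattern I X" by auto
  then show ?thesis by blast
qed

lemma finite_range_determined_by:
  assumes "determined_by I X f" "finite I" "finite X"
  shows "finite (range f)"
proof -
  obtain g where "f = g \<circ> threshold_pattern I X"
    using determined_by_factor[OF assms(1)] by blast
  then have "range f \<subseteq> g ` Pow (I \<times> X)"
    by (auto simp: threshold_pattern_def)
  then show ?thesis
    by (rule finite_subset) (use assms in auto)
qed

lemma measurable_determined_by:
  fixes f :: "('i \<Rightarrow> real) \<Rightarrow> real"
  assumes f: "determined_by I X f" and fin: "finite I" "finite X"
    and sets: "\<And>i. i \<in> I \<Longrightarrow> sets (M i) = sets borel"
  shows "f \<in> borel_measurable (PiM I M)"
proof -
  let ?sig = "threshold_pattern I X"
  obtain g where g: "f = g \<circ> ?sig"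
    using determined_by_factor[OF f] by blast
  have meas: "?sig \<in> measurable (PiM I M) (count_space (Pow (I \<times> X)))"
  proof (subst measurable_count_space_eq2)
    show "finite (Pow (I \<times> X))" using fin by simp
    show "?sig \<in> space (PiM I M) \<rightarrow> Pow (I \<times> X) \<and>
        (\<forall>a\<in>Pow (I \<times> X). ?sig -` {a} \<inter> space (PiM I M) \<in> sets (PiM I M))"
    proof (intro conjI ballI)
      show "?sig \<in> space (PiM I M) \<rightarrow> Pow (I \<times> X)" by (auto simp: threshold_pattern_def)
      fix a assume a: "a \<in> Pow (I \<times> X)"
      have comp: "(\<lambda>p. p i) \<in> borel_measurable (PiM I M)" if "i \<in> I" for i
        using measurable_component_singleton[OF that, of M]
        unfolding measurable_cong_sets[OF refl sets[OF that]] .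
      have eq: "?sig -` {a} \<inter> space (PiM I M) =
          {p \<in> space (PiM I M). \<forall>z\<in>I \<times> X. p (fst z) \<le> snd z \<longleftrightarrow> z \<in> a}"
      proof -
        have "?sig p = a \<longleftrightarrow> (\<forall>z\<in>I \<times> X. p (fst z) \<le> snd z \<longleftrightarrow> z \<in> a)" for p
          using a unfolding threshold_pattern_def by blast
        then show ?thesis by blast
      qed
      have m1: "{p \<in> space (PiM I M). p (fst z) \<le> snd z} \<in> sets (PiM I M)" if "z \<in> I \<times> X" for z
      proof -
        have "fst z \<in> I" using that by auto
        show ?thesis by (rule borel_measurable_le[OF comp[OF \<open>fst z \<in> I\<close>] borel_measurable_const])
      qed
      have m: "{p \<in> space (PiM I M). p (fst z) \<le> snd z \<longleftrightarrow> z \<in> a} \<in> sets (PiM I M)"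
        if "z \<in> I \<times> X" for z
      proof (cases "z \<in> a")
        case False
        have "{p \<in> space (PiM I M). \<not> p (fst z) \<le> snd z} \<in> sets (PiM I M)"
          by (rule sets.sets_Collect_neg[OF m1[OF that]])
        then show ?thesis using False by simp
      qed (use m1[OF that] in simp)
      show "?sig -` {a} \<inter> space (PiM I M) \<in> sets (PiM I M)"
        unfolding eq by (rule sets.sets_Collect_finite_All[OF m])
          (use fin in auto)
    qed
  qed
  show ?thesis
    unfolding g by (rule measurable_comp[OF meas]) simp
qed

locale real_product =
  fixes I :: "'i set" and M :: "'i \<Rightarrow> real measure"
  assumes finite_I: "finite I"
    and prob_M: "\<And>i. prob_space (M i)"
    and sets_M: "\<And>i. sets (M i) = sets borel"
begin

sublocale product_prob_space M I
  by (simp add: prob_M product_prob_spaceI)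

abbreviation "E f \<equiv> integral\<^sup>L (PiM I M) f"

lemma measurable_det:
  fixes f :: "('i \<Rightarrow> real) \<Rightarrow> real"
  shows "determined_by J X f \<Longrightarrow> finite X \<Longrightarrow> J \<subseteq> I \<Longrightarrow> f \<in> borel_measurable (PiM I M)"
  by (rule measurable_determined_by[of I X])
     (simp_all add: determined_by_mono finite_I sets_M)

lemma integrable_det:
  fixes f :: "('i \<Rightarrow> real) \<Rightarrow> real"
  assumes "determined_by J X f" "finite X" "J \<subseteq> I"
  shows "integrable (PiM I M) f"
proof -
  have "finite (range f)"
    using assms finite_I by (intro finite_range_determined_by[of J X]) (auto intro: finite_subset)
  then have fin: "finite (range (\<lambda>p. norm (f p)))"
    by (metis finite_imageI image_image)
  then have "norm (f p) \<le> Max (range (\<lambda>p. norm (f p)))" for p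
    by (intro Max_ge) auto
  then show ?thesis
    by (intro P.integrable_const_bound measurable_det[OF assms] AE_I2)
qed

lemma integrable_coordinate:
  fixes f :: "('i \<Rightarrow> real) \<Rightarrow> real"
  assumes f: "determined_by I X f" and X: "finite X"
  shows "integrable (M i) (\<lambda>y. f (p(i := y)))"
proof -
  define g where "g = (\<lambda>q. f (p(i := q i)))"
  have g: "determined_by {i} X g"
    unfolding g_def by (intro determined_byI) (auto intro!: determined_byD[OF f])
  have "g \<in> borel_measurable (PiM {i} M)"
    by (rule measurable_determined_by[OF g]) (auto simp: X sets_M)
  moreover have "(\<lambda>y. \<lambda>k\<in>{i}. y) \<in> measurable (M i) (PiM {i} M)"
    by (rule measurable_restrict) auto
  ultimately have "(\<lambda>y. g (\<lambda>k\<in>{i}. y)) \<in> borel_measurable (M i)"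
    by (rule measurable_compose[rotated])
  then have meas: "(\<lambda>y. f (p(i := y))) \<in> borel_measurable (M i)"
    by (simp add: g_def)
  have "finite (range g)"
    by (rule finite_range_determined_by[OF g]) (auto simp: X)
  then have "finite ((\<lambda>v. norm v) ` range g)" by simp
  moreover have "norm (f (p(i := y))) \<in> (\<lambda>v. norm v) ` range g" for y
    by (intro imageI range_eqI[of _ _ "\<lambda>_. y"]) (simp add: g_def)
  ultimately have "norm (f (p(i := y))) \<le> Max ((\<lambda>v. norm v) ` range g)" for y
    by (intro Max_ge)
  then show ?thesis
    by (intro M.integrable_const_bound[OF _ meas] AE_I2)
qed

lemma det_coordinate:
  fixes f :: "('i \<Rightarrow> real) \<Rightarrow> real"
  assumes "determined_by I X f"
  shows "determined_by I X (\<lambda>p. \<integral>y. f (p(i := y)) \<partial>M i)"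
  by (intro determined_byI Bochner_Integration.integral_cong refl)
     (auto intro!: determined_byD[OF assms])

lemma expectation_coordinate:
  fixes f :: "('i \<Rightarrow> real) \<Rightarrow> real"
  assumes f: "determined_by I X f" and X: "finite X" and i: "i \<in> I"
  shows "E f = E (\<lambda>p. \<integral>y. f (p(i := y)) \<partial>M i)"
proof -
  let ?J = "I - {i}" and ?h = "\<lambda>p. \<integral>y. f (p(i := y)) \<partial>M i"
  have I: "insert i ?J = I" using i by auto
  have J: "finite ?J" "i \<notin> ?J" using finite_I by auto
  note * = product_integral_insert[OF J, unfolded I]
  have "E f = (\<integral>x. ?h x \<partial>PiM ?J M)"
    by (rule *) (rule integrable_det[OF f X order_refl])
  also have "\<dots> = (\<integral>x. (\<integral>z. ?h (x(i := z)) \<partial>M i) \<partial>PiM ?J M)"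
    by (simp add: prob_space.prob_space[OF prob_M])
  also have "\<dots> = E ?h"
    by (rule *[symmetric]) (rule integrable_det[OF det_coordinate[OF f] X order_refl])
  finally show ?thesis .
qed

lemma expectation_mono_coordinate:
  fixes f g :: "('i \<Rightarrow> real) \<Rightarrow> real"
  assumes f: "determined_by I X f" and g: "determined_by I X g" and X: "finite X" and i: "i \<in> I"
    and le: "\<And>p. (\<integral>y. f (p(i := y)) \<partial>M i) \<le> (\<integral>y. g (p(i := y)) \<partial>M i)"
  shows "E f \<le> E g"
  unfolding expectation_coordinate[OF f X i] expectation_coordinate[OF g X i]
  by (intro integral_mono le integrable_det[OF det_coordinate X order_refl] f g)

lemma expectation_mono_det:
  fixes f g :: "('i \<Rightarrow> real) \<Rightarrow> real"
  assumes "determined_by J X f" "determined_by J X g" "finite X" "J \<subseteq> I" "\<And>p. f p \<le> g p"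
  shows "E f \<le> E g"
  by (intro integral_mono integrable_det[of J X] assms)

lemma expectation_restrict:
  fixes f :: "('i \<Rightarrow> real) \<Rightarrow> real"
  assumes f: "determined_by J X f" and X: "finite X" and J: "J \<subseteq> I"
  shows "E f = integral\<^sup>L (PiM J M) f"
proof -
  have fm: "f \<in> borel_measurable (PiM J M)"
    using J by (intro measurable_determined_by[OF f]) (auto simp: sets_M X intro: finite_subset[OF _ finite_I])
  have "integral\<^sup>L (PiM J M) f = E (\<lambda>p. f (restrict p J))"
    by (subst distr_restrict[OF J finite_I], subst integral_distr)
       (auto intro!: measurable_restrict_subset J fm)
  also have "\<dots> = E f"
    by (simp add: determined_by_restrict[OF f])
  finally show ?thesis by simp
qed

end

section \<open>The laws of the p-values\<close>

lemma cdf_ext_mono: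
  assumes "F \<in> cdf_class" "x \<le> y"
  shows "cdf_ext F x \<le> cdf_ext F y"
proof -
  have "mono_on {0..1} F" "F ` {0..1} \<subseteq> {0..1}" "F 1 = 1"
    using assms by (auto simp: cdf_class_def)
  then have "F u \<le> F v" if "0 \<le> u" "u \<le> v" "v \<le> 1" for u v
    using that by (auto simp: mono_on_def)
  moreover have "0 \<le> F u \<and> F u \<le> 1" if "0 \<le> u" "u \<le> 1" for u
    using \<open>F ` {0..1} \<subseteq> {0..1}\<close> that by (force simp: image_subset_iff)
  ultimately show ?thesis
    using assms(2) by (auto simp: cdf_ext_def)
qed

lemma cdf_ext_right_continuous:
  assumes F: "F \<in> cdf_class"
  shows "continuous (at_right a) (cdf_ext F)"
  unfolding continuous_within
proof -
  have cont: "continuous_on {0..1} F" and F1: "F 1 = 1"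
    using F by (auto simp: cdf_class_def)
  consider "a < 0" | "0 \<le> a" "a < 1" | "1 \<le> a" by linarith
  then show "(cdf_ext F \<longlongrightarrow> cdf_ext F a) (at_right a)"
  proof cases
    case 1
    have "\<forall>\<^sub>F x in at_right a. cdf_ext F a = cdf_ext F x"
      using eventually_at_right_less[of a] eventually_at_right_real[OF 1]
      by eventually_elim (use 1 in \<open>auto simp: cdf_ext_def\<close>)
    then show ?thesis
      using Lim_transform_eventually[OF tendsto_const] by blast
  next
    case 2
    have "continuous_on {a..1} F"
      by (rule continuous_on_subset[OF cont]) (use 2 in auto)
    then have "(F \<longlongrightarrow> F a) (at a within {a..1})"
      using 2 by (auto simp: continuous_on_def)
    then have "(F \<longlongrightarrow> F a) (at_right a)"
      using at_within_Icc_at_right[OF 2(2)] by simp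
    moreover have "\<forall>\<^sub>F x in at_right a. F x = cdf_ext F x"
      using eventually_at_right_real[OF 2(2)]
      by eventually_elim (use 2 in \<open>auto simp: cdf_ext_def\<close>)
    ultimately have "(cdf_ext F \<longlongrightarrow> F a) (at_right a)"
      by (rule Lim_transform_eventually)
    then show ?thesis using 2 by (simp add: cdf_ext_def)
  next
    case 3
    have "\<forall>\<^sub>F x in at_right a. cdf_ext F a = cdf_ext F x"
      using eventually_at_right_less[of a]
      by eventually_elim (use 3 F1 in \<open>auto simp: cdf_ext_def\<close>)
    then show ?thesis
      using Lim_transform_eventually[OF tendsto_const] by blast
  qed
qed

lemma cdf_ext_at_bot: "(cdf_ext F \<longlongrightarrow> 0) at_bot"
proof -
  have "\<forall>\<^sub>F x in at_bot. 0 = cdf_ext F x"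
    using eventually_gt_at_bot eventually_at_bot_linorder[of "\<lambda>x. 0 = cdf_ext F x"]
    by (auto intro!: exI[of _ "-1"] simp: cdf_ext_def)
  then show ?thesis by (rule Lim_transform_eventually[OF tendsto_const])
qed

lemma cdf_ext_at_top: "(cdf_ext F \<longlongrightarrow> 1) at_top"
proof -
  have "\<forall>\<^sub>F x in at_top. 1 = cdf_ext F x"
    by (auto intro!: exI[of _ "2"] simp: cdf_ext_def eventually_at_top_linorder)
  then show ?thesis by (rule Lim_transform_eventually[OF tendsto_const])
qed

lemma
  assumes "F \<in> cdf_class"
  shows real_distribution_law: "real_distribution (law F)"
    and measure_law: "measure (law F) {..x} = cdf_ext F x"
  unfolding law_def
  using assms
  by (auto intro!: real_distribution_interval_measure measure_interval_measure_Iic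
      cdf_ext_mono cdf_ext_right_continuous cdf_ext_at_bot cdf_ext_at_top)

lemma prob_space_law: "F \<in> cdf_class \<Longrightarrow> prob_space (law F)"
  using real_distribution_law by (auto simp: real_distribution_def)

lemma sets_law: "sets (law F) = sets borel"
  by (simp add: law_def)

lemma id_cdf_class: "(\<lambda>x. x) \<in> cdf_class"
  by (auto simp: cdf_class_def mono_on_def)

lemma one_cdf_class: "(\<lambda>_. 1) \<in> cdf_class"
  by (auto simp: cdf_class_def mono_on_def)

lemma AE_law_one: "AE y in law (\<lambda>_. 1). y \<le> 0"
proof -
  interpret prob_space "law (\<lambda>_. 1)" by (rule prob_space_law[OF one_cdf_class])
  have "{..0} \<in> events" by (simp add: sets_law)
  moreover have "prob {..0} = 1"
    by (simp add: measure_law[OF one_cdf_class] cdf_ext_def)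
  ultimately have "AE y in law (\<lambda>_. 1). y \<in> {..0}"
    by (simp add: prob_eq_1)
  then show ?thesis by simp
qed

abbreviation "unif \<equiv> law (\<lambda>x. x)"

lemma prob_space_unif: "prob_space unif"
  by (rule prob_space_law[OF id_cdf_class])

lemma integrable_unif_le: "integrable unif (\<lambda>y. of_bool (y \<le> x) :: real)"
proof -
  interpret prob_space unif by (rule prob_space_unif)
  have "(\<lambda>y. of_bool (y \<le> x) :: real) = indicator {..x}"
    by (auto simp: indicator_def)
  moreover have "{..x} \<in> events" by (simp add: sets_law)
  ultimately show ?thesis by (simp add: emeasure_finite less_top[symmetric])
qed

lemma integral_unif_le:
  assumes "0 \<le> x" "x \<le> 1"
  shows "(\<integral>y. of_bool (y \<le> x) \<partial>unif) = x"
proof -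
  interpret prob_space unif by (rule prob_space_unif)
  have "(\<lambda>y. of_bool (y \<le> x) :: real) = indicator {..x}"
    by (auto simp: indicator_def)
  moreover have "{..x} \<in> events" by (simp add: sets_law)
  ultimately have "(\<integral>y. of_bool (y \<le> x) \<partial>unif) = prob {..x}"
    by simp
  then show ?thesis
    using assms by (simp add: measure_law[OF id_cdf_class] cdf_ext_def)
qed

lemma integrable_unif_if: "integrable unif (\<lambda>y. if y \<le> x then a else b :: real)"
  and integral_unif_if:
    "0 \<le> x \<Longrightarrow> x \<le> 1 \<Longrightarrow> (\<integral>y. (if y \<le> x then a else b) \<partial>unif) = a * x + b * (1 - x)"
proof -
  interpret prob_space unif by (rule prob_space_unif)
  have eq: "(\<lambda>y. if y \<le> x then a else b) = (\<lambda>y. (a - b) * of_bool (y \<le> x) + b)"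
    by auto
  show "integrable unif (\<lambda>y. if y \<le> x then a else b)"
    unfolding eq
    by (intro Bochner_Integration.integrable_add integrable_mult_right integrable_unif_le) auto
  assume "0 \<le> x" "x \<le> 1"
  then show "(\<integral>y. (if y \<le> x then a else b) \<partial>unif) = a * x + b * (1 - x)"
    unfolding eq
    by (subst Bochner_Integration.integral_add)
       (auto simp: integral_unif_le integrable_unif_le prob_space algebra_simps)
qed

text \<open>Fubini in one coordinate at a time, through the hybrid products in which only the factors of a
  subset of \<open>J\<close> have been replaced.\<close>
lemma (in real_product) expectation_prod_cong:
  fixes A :: "('i \<Rightarrow> real) \<Rightarrow> real" and g h :: "real \<Rightarrow> real"
  assumes A: "determined_by I X A" and X: "finite X" and J: "J \<subseteq> I"
    and g: "\<And>y y'. (\<And>x. x \<in> X \<Longrightarrow> y \<le> x \<longleftrightarrow> y' \<le> x) \<Longrightarrow> g y = g y'"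
    and h: "\<And>y y'. (\<And>x. x \<in> X \<Longrightarrow> y \<le> x \<longleftrightarrow> y' \<le> x) \<Longrightarrow> h y = h y'"
    and int: "\<And>j. integrable (M j) g" "\<And>j. integrable (M j) h"
    and eq: "\<And>j. integral\<^sup>L (M j) g = integral\<^sup>L (M j) h"
    and flat: "\<And>p j. j \<in> J \<Longrightarrow> \<exists>\<alpha>. \<forall>y. A (p(j := y)) * (g y - h y) = \<alpha> * (g y - h y)"
  shows "E (\<lambda>p. A p * (\<Prod>j\<in>J. g (p j))) = E (\<lambda>p. A p * (\<Prod>j\<in>J. h (p j)))"
proof -
  have finJ: "finite J" using J finite_I by (rule finite_subset)
  have det1: "determined_by I X (\<lambda>p. g (p j))" "determined_by I X (\<lambda>p. h (p j))" if "j \<in> J" for j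
    using that J by (auto intro!: determined_byI g h)
  define R where "R = (\<lambda>K p. (\<Prod>k\<in>K. g (p k)) * (\<Prod>k\<in>J - K. h (p k)))"
  have detR: "determined_by I X (\<lambda>p. A p * R K p)" if "K \<subseteq> J" for K
    unfolding R_def
    by (intro determined_by_comp2[of I X _ _ "(*)"] A determined_by_prod det1) (use that in auto)
  have "E (\<lambda>p. A p * R {} p) = E (\<lambda>p. A p * R K p)" if "K \<subseteq> J" for K
    using finite_subset[OF that finJ] that
  proof (induction K rule: finite_induct)
    case (insert j K)
    then have j: "j \<in> J" "j \<in> I" "j \<notin> K" using J by auto
    let ?S = "\<lambda>p. (\<Prod>k\<in>K. g (p k)) * (\<Prod>k\<in>J - insert j K. h (p k))"
    have R1: "R (insert j K) p = g (p j) * ?S p" for p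
      using insert by (simp add: R_def)
    have R2: "R K p = h (p j) * ?S p" for p
    proof -
      have "prod (\<lambda>k. h (p k)) (J - K) = h (p j) * prod (\<lambda>k. h (p k)) (J - K - {j})"
        using j finJ by (intro prod.remove) auto
      moreover have "J - K - {j} = J - insert j K" by auto
      ultimately show ?thesis by (simp add: R_def)
    qed
    have S: "?S (p(j := y)) = ?S p" for p y
      using j by (auto intro!: arg_cong2[where f = "(*)"] prod.cong)
    have "(\<integral>y. A (p(j := y)) * R (insert j K) (p(j := y)) \<partial>M j) =
          (\<integral>y. A (p(j := y)) * R K (p(j := y)) \<partial>M j)" for p
    proof -
      obtain \<alpha> where \<alpha>: "\<And>y. A (p(j := y)) * (g y - h y) = \<alpha> * (g y - h y)"
        using flat[OF j(1)] by blast
      have "(\<integral>y. A (p(j := y)) * R (insert j K) (p(j := y)) \<partial>M j) -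
            (\<integral>y. A (p(j := y)) * R K (p(j := y)) \<partial>M j) =
          (\<integral>y. A (p(j := y)) * R (insert j K) (p(j := y)) - A (p(j := y)) * R K (p(j := y)) \<partial>M j)"
        using insert.prems
        by (intro Bochner_Integration.integral_diff[symmetric] integrable_coordinate[OF detR X]) auto
      also have "\<dots> = (\<integral>y. \<alpha> * ?S p * (g y - h y) \<partial>M j)"
      proof (intro Bochner_Integration.integral_cong refl)
        fix y
        have "A (p(j := y)) * R (insert j K) (p(j := y)) - A (p(j := y)) * R K (p(j := y)) =
            (A (p(j := y)) * (g y - h y)) * ?S p"
          unfolding R1 R2 S by (simp add: algebra_simps)
        then show "A (p(j := y)) * R (insert j K) (p(j := y)) - A (p(j := y)) * R K (p(j := y)) =
            \<alpha> * ?S p * (g y - h y)"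
          unfolding \<alpha> by (simp add: algebra_simps)
      qed
      also have "\<dots> = 0"
        using eq int by simp
      finally show ?thesis by simp
    qed
    then have "E (\<lambda>p. A p * R (insert j K) p) = E (\<lambda>p. A p * R K p)"
      using expectation_coordinate[OF detR[of "insert j K"] X j(2)]
        expectation_coordinate[OF detR[of K] X j(2)] insert.prems by simp
    then show ?case using insert by simp
  qed simp
  from this[OF order_refl] show ?thesis
    by (simp add: R_def)
qed

section \<open>Tail bounds for the empirical distribution function\<close>

lemma ln_ge_pade:
  assumes "1 \<le> (z::real)"
  shows "2 * (z - 1) / (z + 1) \<le> ln z"
proof -
  let ?h = "\<lambda>z::real. ln z - 2 * (z - 1) / (z + 1)"
  have "?h 1 \<le> ?h z"
  proof (rule DERIV_nonneg_imp_nondecreasing[OF assms])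
    fix x :: real assume x: "1 \<le> x" "x \<le> z"
    have "(?h has_real_derivative 1 / x - (2 * (x + 1) - 2 * (x - 1)) / ((x + 1) * (x + 1))) (at x)"
      using x by (auto intro!: derivative_eq_intros)
    moreover have "1 / x - (2 * (x + 1) - 2 * (x - 1)) / ((x + 1) * (x + 1)) = (x - 1)\<^sup>2 / (x * (x + 1)\<^sup>2)"
      using x by (simp add: divide_simps power2_eq_square) (simp add: algebra_simps)
    moreover have "(x - 1)\<^sup>2 / (x * (x + 1)\<^sup>2) \<ge> 0" using x by simp
    ultimately show "\<exists>y. (?h has_real_derivative y) (at x) \<and> y \<ge> 0" by metis
  qed
  then show ?thesis by simp
qed

lemma ln_le_half_diff_inverse:
  assumes "1 \<le> (z::real)"
  shows "ln z \<le> (z - 1 / z) / 2"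
proof -
  let ?h = "\<lambda>z::real. (z - 1 / z) / 2 - ln z"
  have "?h 1 \<le> ?h z"
  proof (rule DERIV_nonneg_imp_nondecreasing[OF assms])
    fix x :: real assume x: "1 \<le> x" "x \<le> z"
    have "(?h has_real_derivative (1 + 1 / (x * x)) / 2 - 1 / x) (at x)"
      using x by (auto intro!: derivative_eq_intros)
    moreover have "(1 + 1 / (x * x)) / 2 - 1 / x = (1 - 1 / x)\<^sup>2 / 2"
      using x by (simp add: divide_simps power2_eq_square) (simp add: algebra_simps)
    moreover have "(1 - 1 / x)\<^sup>2 / 2 \<ge> 0" by simp
    ultimately show "\<exists>y. (?h has_real_derivative y) (at x) \<and> y \<ge> 0" by metis
  qed
  then show ?thesis by simp
qed

text \<open>With this choice of \<open>\<psi>\<close> the Pade bound for the logarithm of the second factor is exactly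
  \<open>2 s x / (1 + s - x)\<close>, so that it cancels against its exponent \<open>n (1 + s - x)\<close>.\<close>
lemma likelihood_lower_bound:
  fixes n N :: nat and s x :: real
  assumes s: "0 < s" "s < 1" and x: "0 \<le> x" "x < 1" and N: "N \<le> n" "real N \<le> n * (x - s)"
  defines "\<psi> \<equiv> (1 - s) / (1 + s)"
  shows "exp (2 * n * s\<^sup>2 / (1 + s)) \<le> \<psi> ^ N * ((1 - \<psi> * x) / (1 - x)) ^ (n - N)"
proof (cases "n = 0")
  case False
  define z where "z = (1 - \<psi> * x) / (1 - x)"
  have \<psi>: "0 < \<psi>" "\<psi> < 1" using s by (auto simp: \<psi>_def)
  have "\<psi> * x \<le> 1 * x" using \<psi> x by (intro mult_right_mono) auto
  then have z1: "1 \<le> z" using x by (simp add: z_def)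
  have "0 \<le> n * (x - s)" using N by linarith
  then have xs: "s \<le> x" using False by (simp add: zero_le_mult_iff)
  have pos: "0 < 1 + s - x" "1 - x \<noteq> 0" "1 + s \<noteq> 0" using x s by auto
  have "2 * (z - 1) / (z + 1) = 2 * s * x / (1 + s - x)"
  proof -
    have "z - 1 = 2 * s * x / ((1 + s) * (1 - x))"
      using pos by (simp add: z_def \<psi>_def divide_simps) (simp add: algebra_simps)
    moreover have "z + 1 = 2 * (1 + s - x) / ((1 + s) * (1 - x))"
      using pos by (simp add: z_def \<psi>_def divide_simps) (simp add: algebra_simps)
    ultimately have "2 * (z - 1) / (z + 1) = 2 * (2 * s * x) / (2 * (1 + s - x))"
      using pos by (simp only: times_divide_eq_right divide_divide_eq_right) simp
    then show ?thesis by (simp only: mult_divide_mult_cancel_left_if) simp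
  qed
  then have "2 * s * x / (1 + s - x) \<le> ln z"
    using ln_ge_pade[OF z1] by simp
  then have a: "2 * s * x \<le> (1 - x + s) * ln z"
    using pos by (simp add: field_simps)
  have "- ln \<psi> = ln (1 / \<psi>)" using \<psi> by (simp add: ln_div)
  also have "\<dots> \<le> (1 / \<psi> - 1 / (1 / \<psi>)) / 2"
    using \<psi> by (intro ln_le_half_diff_inverse) simp
  also have "\<dots> = 2 * s / ((1 - s) * (1 + s))"
  proof -
    have "1 / \<psi> - 1 / (1 / \<psi>) = (1 + s) / (1 - s) - (1 - s) / (1 + s)"
      by (simp add: \<psi>_def)
    also have "\<dots> = 4 * s / ((1 - s) * (1 + s))"
      using s by (simp add: divide_simps) (simp add: algebra_simps)
    finally show ?thesis by simp
  qed
  finally have "- ln \<psi> \<le> 2 * s / ((1 - s) * (1 + s))" .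
  then have "(x - s) * (- ln \<psi>) \<le> (x - s) * (2 * s / ((1 - s) * (1 + s)))"
    using xs by (intro mult_left_mono) auto
  then have b: "2 * s * x - (x - s) * (2 * s / ((1 - s) * (1 + s))) \<le> (1 - x + s) * ln z + (x - s) * ln \<psi>"
    using a by linarith
  have "2 * s\<^sup>2 / (1 + s) = 2 * s\<^sup>2 * (1 - s) / ((1 - s) * (1 + s))" using s by simp
  also have "\<dots> \<le> 2 * s\<^sup>2 * (1 - x * s) / ((1 - s) * (1 + s))"
    using s x by (intro divide_right_mono mult_left_mono) auto
  also have "\<dots> = 2 * s * x - (x - s) * (2 * s / ((1 - s) * (1 + s)))"
    using s by (simp add: divide_simps power2_eq_square) (simp add: algebra_simps)
  finally have c: "2 * s\<^sup>2 / (1 + s) \<le> (1 - x + s) * ln z + (x - s) * ln \<psi>"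
    using b by linarith
  have ln: "0 \<le> ln z - ln \<psi>" using z1 \<psi> ln_ge_zero[OF z1] ln_le_zero_iff[of \<psi>] by linarith
  have "2 * n * s\<^sup>2 / (1 + s) = n * (2 * s\<^sup>2 / (1 + s))" by simp
  also have "\<dots> \<le> n * ((1 - x + s) * ln z + (x - s) * ln \<psi>)"
    using c by (intro mult_left_mono) auto
  also have "\<dots> = n * ln z - (n * (x - s)) * (ln z - ln \<psi>)" by (simp add: algebra_simps)
  also have "\<dots> \<le> n * ln z - N * (ln z - ln \<psi>)"
    using mult_right_mono[OF N(2) ln] by linarith
  also have "\<dots> = ln (\<psi> ^ N * z ^ (n - N))"
    using \<psi> z1 N(1) by (simp add: ln_mult ln_realpow algebra_simps)
  finally show ?thesis
    using \<psi> z1 unfolding z_def[symmetric] by (simp add: ln_ge_iff)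
qed (use N in simp)

locale unif_product =
  fixes I :: "'i set"
  assumes fin_I: "finite I"
begin

sublocale real_product I "\<lambda>_. unif"
  by (rule real_product.intro) (simp_all add: fin_I prob_space_unif sets_law)

text \<open>The density with value \<open>\<psi>\<close> on \<open>[0, x]\<close> and constant on \<open>(x, 1]\<close>, evaluated at the sample: a
  martingale in \<open>x\<close>, because the value of a factor is frozen once \<open>p j \<le> x\<close>.\<close>
definition lik :: "real \<Rightarrow> 'i set \<Rightarrow> real \<Rightarrow> ('i \<Rightarrow> real) \<Rightarrow> real" where
  "lik \<psi> J x p = (\<Prod>j\<in>J. if p j \<le> x then \<psi> else (1 - \<psi> * x) / (1 - x))"

lemma determined_by_lik: "J \<subseteq> I \<Longrightarrow> x \<in> X \<Longrightarrow> determined_by I X (lik \<psi> J x)"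
  unfolding lik_def by (intro determined_by_prod determined_byI) auto

lemma lik_nonneg:
  assumes "0 \<le> \<psi>" "\<psi> \<le> 1" "0 \<le> x" "x < 1"
  shows "0 \<le> lik \<psi> J x p"
proof -
  have "\<psi> * x \<le> 1" using assms by (intro mult_le_one) auto
  then show ?thesis using assms unfolding lik_def by (intro prod_nonneg) auto
qed

lemma integral_lik_factor:
  assumes "0 \<le> x" "x < 1"
  shows "(\<integral>y. (if y \<le> x then \<psi> else (1 - \<psi> * x) / (1 - x)) \<partial>unif) = 1"
  using assms by (subst integral_unif_if) auto

lemma expectation_lik:
  assumes x: "0 \<le> x" "x < 1" and J: "J \<subseteq> I"
  shows "E (lik \<psi> J x) = 1"
proof -
  have "E (\<lambda>p. 1 * (\<Prod>j\<in>J. (\<lambda>y. if y \<le> x then \<psi> else (1 - \<psi> * x) / (1 - x)) (p j))) =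
      E (\<lambda>p. 1 * (\<Prod>j\<in>J. (\<lambda>_. 1) (p j)))"
    by (rule expectation_prod_cong[of "{x}"])
      (use J x in \<open>auto intro!: determined_byI integrable_unif_if simp: integral_lik_factor prob_space.prob_space[OF prob_space_unif]\<close>)
  then show ?thesis by (simp add: lik_def[abs_def] P.prob_space)
qed

lemma lik_martingale:
  assumes A: "determined_by I Y A" and Y: "finite Y" "Y \<subseteq> {..x}"
    and x: "0 \<le> x" "x \<le> z" "z < 1" and J: "J \<subseteq> I"
  shows "E (\<lambda>p. A p * lik \<psi> J x p) = E (\<lambda>p. A p * lik \<psi> J z p)"
  unfolding lik_def
proof (rule expectation_prod_cong[of "insert x (insert z Y)"
      A J "\<lambda>y. if y \<le> x then \<psi> else (1 - \<psi> * x) / (1 - x)"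
      "\<lambda>y. if y \<le> z then \<psi> else (1 - \<psi> * z) / (1 - z)"])
  fix p :: "'i \<Rightarrow> real" and j
  let ?d = "\<lambda>y. (if y \<le> x then \<psi> else (1 - \<psi> * x) / (1 - x)) -
      (if y \<le> z then \<psi> else (1 - \<psi> * z) / (1 - z))"
  have "A (p(j := y)) * ?d y = A (p(j := x + 1)) * ?d y" for y
  proof (cases "y \<le> x")
    case False
    have "A (p(j := y)) = A (p(j := x + 1))"
      by (rule determined_byD[OF A]) (use Y False in force)
    then show ?thesis by simp
  qed (use x in simp)
  then show "\<exists>\<alpha>. \<forall>y. A (p(j := y)) * ?d y = \<alpha> * ?d y" by blast
qed (use assms in \<open>auto intro: determined_by_mono integrable_unif_if simp: integral_lik_factor\<close>)

lemma ville:
  assumes X: "finite X" "X \<subseteq> {0..<1}" and J: "J \<subseteq> I" and \<psi>: "0 \<le> \<psi>" "\<psi> \<le> 1"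
  shows "B * E (\<lambda>p. of_bool (\<exists>x\<in>X. B \<le> lik \<psi> J x p)) \<le> 1"
proof -
  define hit where "hit = (\<lambda>X p. \<exists>x\<in>X. B \<le> lik \<psi> J x p)"
  have det: "determined_by I X (hit X)" for X
    unfolding hit_def
    by (intro determined_by_bex determined_by_comp[of _ _ _ "\<lambda>l. B \<le> l"] determined_by_lik J)
  have main: "B * E (\<lambda>p. of_bool (hit X p)) \<le> E (\<lambda>p. of_bool (hit X p) * lik \<psi> J z p)"
    if "\<forall>x\<in>X. x \<le> z" "0 \<le> z" "z < 1" for z
    using X that
  proof (induction X arbitrary: z rule: finite_linorder_max_induct)
    case empty
    then show ?case by (simp add: hit_def)
  next
    case (insert b X)
    let ?Y = "insert b X"
    define new where "new = (\<lambda>p. \<not> hit X p \<and> B \<le> lik \<psi> J b p)"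
    have b: "0 \<le> b" "b \<le> z" "b < 1" using insert.prems by auto
    have detb: "determined_by I ?Y (lik \<psi> J b)" by (rule determined_by_lik[OF J]) simp
    have deth: "determined_by I ?Y (hit X)" by (rule determined_by_mono[OF det]) auto
    have detn: "determined_by I ?Y new"
      unfolding new_def
      by (rule determined_by_comp2[of _ _ _ _ "\<lambda>h l. \<not> h \<and> B \<le> l"]) (fact deth detb)+
    have split: "of_bool (hit ?Y p) = of_bool (hit X p) + (of_bool (new p) :: real)" for p
      by (auto simp: hit_def new_def)
    have finY: "finite ?Y" using insert by simp
    note integr = integrable_det[OF _ finY order_refl]
    have i1: "integrable (PiM I (\<lambda>_. unif)) (\<lambda>p. of_bool (hit X p) :: real)"
      by (intro integr determined_by_comp[OF deth])
    have i2: "integrable (PiM I (\<lambda>_. unif)) (\<lambda>p. of_bool (new p) :: real)"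
      by (intro integr determined_by_comp[OF detn])
    have i3: "integrable (PiM I (\<lambda>_. unif)) (\<lambda>p. of_bool (hit X p) * lik \<psi> J b p :: real)"
      by (intro integr determined_by_comp2[OF deth detb])
    have i4: "integrable (PiM I (\<lambda>_. unif)) (\<lambda>p. of_bool (new p) * lik \<psi> J b p :: real)"
      by (intro integr determined_by_comp2[OF detn detb])
    have "B * E (\<lambda>p. of_bool (hit ?Y p)) = B * E (\<lambda>p. of_bool (hit X p)) + E (\<lambda>p. B * of_bool (new p))"
      unfolding split by (simp add: i1 i2 algebra_simps)
    also have "\<dots> \<le> E (\<lambda>p. of_bool (hit X p) * lik \<psi> J b p) + E (\<lambda>p. of_bool (new p) * lik \<psi> J b p)"
    proof (rule add_mono)
      show "B * E (\<lambda>p. of_bool (hit X p)) \<le> E (\<lambda>p. of_bool (hit X p) * lik \<psi> J b p)"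
        using insert.IH[of b] insert.hyps insert.prems b by (auto simp: less_imp_le)
      show "E (\<lambda>p. B * of_bool (new p)) \<le> E (\<lambda>p. of_bool (new p) * lik \<psi> J b p)"
        by (intro integral_mono i4 integrable_mult_right i2) (auto simp: new_def)
    qed
    also have "\<dots> = E (\<lambda>p. of_bool (hit ?Y p) * lik \<psi> J b p)"
      unfolding split by (simp add: i3 i4 algebra_simps)
    also have "\<dots> = E (\<lambda>p. of_bool (hit ?Y p) * lik \<psi> J z p)"
      by (rule lik_martingale[OF determined_by_comp[OF det] finY])
        (use insert.hyps insert.prems b J in \<open>auto simp: less_imp_le\<close>)
    finally show ?case .
  qed
  define z where "z = Max (insert 0 X)"
  have z: "\<forall>x\<in>X. x \<le> z" "0 \<le> z" "z < 1"
    using X by (auto simp: z_def)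
  have detz: "determined_by I (insert z X) (lik \<psi> J z)" by (rule determined_by_lik[OF J]) simp
  have deth: "determined_by I (insert z X) (hit X)" by (rule determined_by_mono[OF det]) auto
  have "B * E (\<lambda>p. of_bool (hit X p)) \<le> E (\<lambda>p. of_bool (hit X p) * lik \<psi> J z p)"
    by (rule main[OF z])
  also have "\<dots> \<le> E (lik \<psi> J z)"
    by (rule expectation_mono_det[OF determined_by_comp2[OF deth detz] detz])
      (use X lik_nonneg[OF \<psi> z(2,3)] in auto)
  also have "\<dots> = 1" by (rule expectation_lik[OF z(2,3) J])
  finally show ?thesis by (simp add: hit_def)
qed

lemma empirical_lower_tail:
  fixes s :: real and X :: "real set"
  assumes X: "finite X" "X \<subseteq> {0..<1}" and J: "J \<subseteq> I" and s: "0 < s" "s < 1"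
  shows "E (\<lambda>p. of_bool (\<exists>x\<in>X. real (card {j\<in>J. p j \<le> x}) \<le> card J * (x - s)))
    \<le> exp (- (2 * card J * s\<^sup>2 / (1 + s)))"
proof -
  define \<psi> where "\<psi> = (1 - s) / (1 + s)"
  define B where "B = exp (2 * card J * s\<^sup>2 / (1 + s))"
  have finJ: "finite J" using J fin_I by (rule finite_subset)
  have \<psi>: "0 \<le> \<psi>" "\<psi> \<le> 1" using s by (auto simp: \<psi>_def)
  have lik_eq: "lik \<psi> J x p =
      \<psi> ^ card {j\<in>J. p j \<le> x} * ((1 - \<psi> * x) / (1 - x)) ^ (card J - card {j\<in>J. p j \<le> x})" for x p
  proof -
    have "J \<inter> - {j. p j \<le> x} = J - {j\<in>J. p j \<le> x}" "J \<inter> {j. p j \<le> x} = {j\<in>J. p j \<le> x}" by auto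
    moreover have "card (J - {j\<in>J. p j \<le> x}) = card J - card {j\<in>J. p j \<le> x}"
      using finJ by (intro card_Diff_subset) auto
    ultimately show ?thesis
      unfolding lik_def using finJ by (simp add: prod.If_cases)
  qed
  have "B \<le> lik \<psi> J x p" if "x \<in> X" "real (card {j\<in>J. p j \<le> x}) \<le> card J * (x - s)" for x p
  proof -
    have "card {j\<in>J. p j \<le> x} \<le> card J" using finJ by (intro card_mono) auto
    moreover have "0 \<le> x" "x < 1" using that X by auto
    ultimately show ?thesis
      unfolding lik_eq B_def using likelihood_lower_bound[OF s, folded \<psi>_def] that(2) by blast
  qed
  then have le: "of_bool (\<exists>x\<in>X. real (card {j\<in>J. p j \<le> x}) \<le> card J * (x - s))
      \<le> (of_bool (\<exists>x\<in>X. B \<le> lik \<psi> J x p) :: real)" for p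
    by auto
  have det1: "determined_by I X (\<lambda>p. of_bool (\<exists>x\<in>X. real (card {j\<in>J. p j \<le> x}) \<le> card J * (x - s)) :: real)"
    by (intro determined_by_comp[of _ _ _ of_bool] determined_by_bex
        determined_by_comp[of _ _ _ "\<lambda>c. real c \<le> _"] determined_by_card J)
  have det2: "determined_by I X (\<lambda>p. of_bool (\<exists>x\<in>X. B \<le> lik \<psi> J x p) :: real)"
    by (intro determined_by_comp[of _ _ _ of_bool] determined_by_bex
        determined_by_comp[of _ _ _ "\<lambda>l. B \<le> l"] determined_by_lik J)
  have "B * E (\<lambda>p. of_bool (\<exists>x\<in>X. real (card {j\<in>J. p j \<le> x}) \<le> card J * (x - s)))
      \<le> B * E (\<lambda>p. of_bool (\<exists>x\<in>X. B \<le> lik \<psi> J x p))"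
    by (intro mult_left_mono expectation_mono_det[OF det1 det2 X(1) order_refl le]) (simp add: B_def)
  also have "\<dots> \<le> 1" by (rule ville[OF X J \<psi>])
  finally show ?thesis
    by (simp add: B_def exp_minus field_simps)
qed

lemma empirical_upper_tail:
  fixes s x :: real
  assumes x: "0 \<le> x" "x \<le> 1" and J: "J \<subseteq> I" and s: "0 \<le> s"
  shows "E (\<lambda>p. of_bool (card J * (x + s) \<le> real (card {j\<in>J. p j \<le> x}))) \<le> exp (- (2 * card J * s\<^sup>2))"
proof -
  have finJ: "finite J" using J fin_I by (rule finite_subset)
  define l where "l = 4 * s"
  define g where "g = (\<lambda>y. if y \<le> x then exp (l * (1 - x - s)) else exp (l * (- x - s)))"
  define c where "c = integral\<^sup>L unif g"
  have g_prod: "(\<Prod>j\<in>J. g (p j)) = exp (l * (real (card {j\<in>J. p j \<le> x}) - card J * (x + s)))" for p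
  proof -
    have "(\<Prod>j\<in>J. g (p j)) = (\<Prod>j\<in>J. exp (l * (of_bool (p j \<le> x) - (x + s))))"
      by (intro prod.cong) (auto simp: g_def algebra_simps)
    also have "\<dots> = exp (\<Sum>j\<in>J. l * (of_bool (p j \<le> x) - (x + s)))"
      using finJ by (simp add: exp_sum)
    also have "(\<Sum>j\<in>J. l * (of_bool (p j \<le> x) - (x + s))) =
        l * ((\<Sum>j\<in>J. of_bool (p j \<le> x)) - card J * (x + s))"
      by (simp add: sum_distrib_left[symmetric] sum_subtractf)
    also have "(\<Sum>j\<in>J. of_bool (p j \<le> x) :: real) = card {j\<in>J. p j \<le> x}"
      using finJ by (simp add: of_bool_def sum.If_cases Int_def)
    finally show ?thesis .
  qed
  have "c = exp (- (l * s) - l * x) * (1 + x * (exp l - 1))"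
    unfolding c_def g_def using x
    by (subst integral_unif_if) (auto simp: exp_diff exp_minus exp_add field_simps)
  also have "1 + x * (exp l - 1) = exp (ln (1 + x * (exp l - 1)))"
  proof -
    have "0 \<le> x * (exp l - 1)" using x s by (simp add: l_def)
    then show ?thesis by simp
  qed
  also have "\<dots> \<le> exp (l * x + l\<^sup>2 / 8)"
    using Hoeffdings_lemma_aux[of l x] x s by (simp add: l_def)
  also have "exp (- (l * s) - l * x) * exp (l * x + l\<^sup>2 / 8) = exp (- (2 * s\<^sup>2))"
    by (simp add: exp_add[symmetric] l_def power2_eq_square)
  finally have c: "c \<le> exp (- (2 * s\<^sup>2))" by simp
  have c0: "0 \<le> c" unfolding c_def g_def by (intro Bochner_Integration.integral_nonneg) auto
  have "E (\<lambda>p. of_bool (card J * (x + s) \<le> real (card {j\<in>J. p j \<le> x}))) \<le> E (\<lambda>p. \<Prod>j\<in>J. g (p j))"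
  proof (rule expectation_mono_det[of J "{x}"])
    show "determined_by J {x} (\<lambda>p. of_bool (card J * (x + s) \<le> real (card {j\<in>J. p j \<le> x})) :: real)"
      by (intro determined_by_comp[of _ _ _ "\<lambda>c. of_bool (_ \<le> real c)"] determined_by_card) auto
    show "determined_by J {x} (\<lambda>p. \<Prod>j\<in>J. g (p j))"
      by (intro determined_by_prod determined_byI) (auto simp: g_def)
    show "of_bool (card J * (x + s) \<le> real (card {j\<in>J. p j \<le> x})) \<le> (\<Prod>j\<in>J. g (p j))" for p
      unfolding g_prod using s by (auto simp: l_def intro!: mult_nonneg_nonneg)
  qed (use J in auto)
  also have "\<dots> = E (\<lambda>p. 1 * (\<Prod>j\<in>J. g (p j)))" by simp
  also have "\<dots> = E (\<lambda>p. 1 * (\<Prod>j\<in>J. (\<lambda>_. c) (p j)))"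
    by (rule expectation_prod_cong[of "{x}"])
      (use J in \<open>auto intro!: determined_byI integrable_unif_if simp: g_def c_def prob_space.prob_space[OF prob_space_unif]\<close>)
  also have "\<dots> = c ^ card J" by (simp add: P.prob_space)
  also have "\<dots> \<le> exp (- (2 * s\<^sup>2)) ^ card J" by (intro power_mono c c0)
  also have "\<dots> = exp (- (2 * card J * s\<^sup>2))"
    by (simp add: exp_of_nat_mult[symmetric] mult_ac)
  finally show ?thesis .
qed

end

context unif_product
begin

lemma upper_event_bound:
  fixes n :: nat and x y \<zeta> \<delta> \<theta> :: real
  assumes J: "J \<subseteq> I" "card J = n" and n: "n < m" and x: "0 \<le> x" "x \<le> 1"
    and y: "\<bar>real n / m - \<zeta>\<bar> \<le> y" and \<theta>: "0 \<le> \<theta>" "\<theta> \<le> 1"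
  shows "E (\<lambda>p. of_bool (m * (G_DU \<zeta> x + \<delta>) - 1 < real (m - n + card {j\<in>J. p j \<le> x})))
    \<le> exp (- 2 * real m * (max 0 (\<delta> - y - 1 / real m))\<^sup>2 * \<theta>)"
proof -
  define s where "s = \<delta> - y - 1 / real m"
  let ?A = "\<lambda>p. m * (G_DU \<zeta> x + \<delta>) - 1 < real (m - n + card {j\<in>J. p j \<le> x})"
  have m: "0 < real m" using n by simp
  have det: "determined_by J {x} (\<lambda>p. of_bool (?A p) :: real)"
    by (intro determined_by_comp[of _ _ _ "\<lambda>c. of_bool (_ < real (m - n + c))"] determined_by_card) auto
  have det1: "determined_by J Y (\<lambda>_. 1 :: real)" for Y by (rule determined_byI) simp
  show ?thesis
  proof (cases "0 < s")
    case False
    have "E (\<lambda>p. of_bool (?A p)) \<le> E (\<lambda>_. 1 :: real)"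
      by (rule expectation_mono_det[OF det det1]) (use J in auto)
    then show ?thesis using False by (simp add: s_def[symmetric] max_def P.prob_space)
  next
    case s: True
    have ny: "\<bar>real n - m * \<zeta>\<bar> \<le> m * y"
    proof -
      have "\<bar>real n - m * \<zeta>\<bar> = m * \<bar>real n / m - \<zeta>\<bar>"
        using m by (simp add: abs_mult[symmetric] field_simps)
      then show ?thesis using y m by simp
    qed
    have A: "n * x + m * s \<le> real (card {j\<in>J. p j \<le> x})" if "?A p" for p
    proof -
      have "(m * \<zeta> - n) * (1 - x) \<le> m * y * (1 - x)"
        using ny x by (intro mult_right_mono) auto
      also have "\<dots> \<le> m * y"
      proof -
        have "0 \<le> m * y" using ny by linarith
        then show ?thesis using x by (simp add: algebra_simps)
      qed
      finally have "(m * \<zeta> - n) * (1 - x) \<le> m * y" .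
      moreover have "m * s = m * \<delta> - m * y - 1" using m by (simp add: s_def algebra_simps)
      moreover have "m * (1 - \<zeta> + \<zeta> * x + \<delta>) - 1 < real m - real n + real (card {j\<in>J. p j \<le> x})"
        using that n by (simp add: G_DU_def)
      ultimately show ?thesis by (simp add: algebra_simps)
    qed
    show ?thesis
    proof (cases "n = 0")
      case True
      then have "J = {}" using J fin_I by (metis card_0_eq finite_subset)
      have "\<not> ?A p" for p
        using A[of p] True \<open>J = {}\<close> s m by (auto simp: mult_le_0_iff)
      then show ?thesis by simp
    next
      case False
      then have n0: "0 < real n" by simp
      let ?s = "m * s / n"
      have "(E (\<lambda>p. of_bool (?A p)) :: real) \<le> E (\<lambda>p. of_bool (card J * (x + ?s) \<le> real (card {j\<in>J. p j \<le> x})))"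
      proof (rule expectation_mono_det[OF det])
        show "determined_by J {x} (\<lambda>p. of_bool (card J * (x + ?s) \<le> real (card {j\<in>J. p j \<le> x})) :: real)"
          by (intro determined_by_comp[of _ _ _ "\<lambda>c. of_bool (_ \<le> real c)"] determined_by_card) auto
        show "of_bool (?A p) \<le> (of_bool (card J * (x + ?s) \<le> real (card {j\<in>J. p j \<le> x})) :: real)" for p
          using A[of p] n0 J by (auto simp: algebra_simps)
      qed (use J in auto)
      also have "\<dots> \<le> exp (- (2 * card J * ?s\<^sup>2))"
        using s by (intro empirical_upper_tail x J) auto
      also have "\<dots> \<le> exp (- 2 * m * s\<^sup>2 * \<theta>)"
      proof -
        have "\<theta> * n \<le> 1 * real m" using \<theta> n by (intro mult_mono) auto
        then have "m * s\<^sup>2 * (\<theta> * n) \<le> m * s\<^sup>2 * m" by (intro mult_left_mono) auto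
        then have "m * s\<^sup>2 * \<theta> \<le> n * ?s\<^sup>2" using n0 by (simp add: field_simps power2_eq_square)
        then show ?thesis using J by simp
      qed
      finally show ?thesis using s by (simp add: s_def[symmetric] max_def)
    qed
  qed
qed

lemma lower_event_bound:
  fixes n :: nat and x y \<zeta> \<delta> \<theta> :: real and X :: "real set"
  assumes J: "J \<subseteq> I" "card J = n" and n: "n < m" and \<zeta>: "\<zeta> < 1" and \<delta>: "0 < \<delta>"
    and X: "finite X" "\<And>u. u \<in> X \<Longrightarrow> 0 < u \<and> u \<le> 1 \<and> u \<le> G_DU \<zeta> (\<rho> u) - \<delta>"
    and \<rho>: "\<And>u. 0 \<le> u \<Longrightarrow> u \<le> 1 \<Longrightarrow> 0 \<le> \<rho> u \<and> \<rho> u \<le> u"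
    and y: "\<bar>real n / m - \<zeta>\<bar> \<le> y" and \<theta>: "0 \<le> \<theta>" "\<theta> \<le> 1"
  shows "E (\<lambda>p. of_bool (\<exists>u\<in>X. real (m - 1 - n + card {j\<in>J. p j \<le> \<rho> u}) < m * u))
    \<le> exp (- 2 * real m * (max 0 (\<delta> - y - 1 / real m))\<^sup>2 * \<theta>)"
proof -
  define s where "s = \<delta> - y - 1 / real m"
  let ?A = "\<lambda>p. \<exists>u\<in>X. real (m - 1 - n + card {j\<in>J. p j \<le> \<rho> u}) < m * u"
  have m: "0 < real m" using n by simp
  have det: "determined_by J (\<rho> ` X) (\<lambda>p. of_bool (?A p) :: real)"
    by (intro determined_by_comp[of _ _ _ of_bool] determined_by_bex
        determined_by_comp[of _ _ _ "\<lambda>c. real (m - 1 - n + c) < _"] determined_by_card) auto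
  have det1: "determined_by J Y (\<lambda>_. 1 :: real)" for Y by (rule determined_byI) simp
  show ?thesis
  proof (cases "0 < s \<and> X \<noteq> {}")
    case False
    have "E (\<lambda>p. of_bool (?A p)) \<le> E (\<lambda>_. 1 :: real)"
      by (rule expectation_mono_det[OF det det1]) (use J X in auto)
    then show ?thesis using False by (auto simp: s_def[symmetric] max_def P.prob_space)
  next
    case True
    then have s: "0 < s" by simp
    have x: "0 \<le> \<rho> u" "\<rho> u < 1" "\<delta> \<le> 1 - \<zeta>" if "u \<in> X" for u
    proof -
      note u = X(2)[OF that]
      then have r: "0 \<le> \<rho> u" "\<rho> u \<le> u" using \<rho>[of u] by auto
      then have "\<delta> \<le> (1 - \<zeta>) * (1 - \<rho> u)" using u by (simp add: G_DU_def algebra_simps)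
      also have "\<dots> \<le> (1 - \<zeta>) * 1" using \<zeta> r by (intro mult_left_mono) auto
      finally show "\<delta> \<le> 1 - \<zeta>" by simp
      show "0 \<le> \<rho> u" by fact
      have "0 < (1 - \<zeta>) * (1 - \<rho> u)" using \<open>\<delta> \<le> (1 - \<zeta>) * (1 - \<rho> u)\<close> \<delta> by linarith
      then show "\<rho> u < 1" using \<zeta> by (simp add: zero_less_mult_iff)
    qed
    have ny: "\<bar>real n - m * \<zeta>\<bar> \<le> m * y"
    proof -
      have "\<bar>real n - m * \<zeta>\<bar> = m * \<bar>real n / m - \<zeta>\<bar>"
        using m by (simp add: abs_mult[symmetric] field_simps)
      then show ?thesis using y m by simp
    qed
    have ms: "m * s = m * \<delta> - m * y - 1" using m by (simp add: s_def algebra_simps)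
    have A: "\<exists>x\<in>\<rho> ` X. real (card {j\<in>J. p j \<le> x}) < n * x - m * s" if A: "?A p" for p
    proof -
      from A obtain u :: real where u: "u \<in> X" "real (m - 1 - n + card {j\<in>J. p j \<le> \<rho> u}) < m * u" by blast
      note r = x[OF u(1)]
      have "m * u \<le> m * (1 - \<zeta> + \<zeta> * \<rho> u - \<delta>)"
        using X(2)[OF u(1)] by (intro mult_left_mono) (auto simp: G_DU_def)
      then have "real m - 1 - n + real (card {j\<in>J. p j \<le> \<rho> u}) < m * (1 - \<zeta> + \<zeta> * \<rho> u - \<delta>)"
      proof -
        have "real (m - 1 - n + card {j\<in>J. p j \<le> \<rho> u}) = real m - 1 - n + real (card {j\<in>J. p j \<le> \<rho> u})"
          using n by (simp add: of_nat_diff)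
        then show ?thesis using u(2) \<open>m * u \<le> m * (1 - \<zeta> + \<zeta> * \<rho> u - \<delta>)\<close> by linarith
      qed
      moreover have "(n - m * \<zeta>) * (1 - \<rho> u) \<le> m * y"
      proof -
        have "(n - m * \<zeta>) * (1 - \<rho> u) \<le> m * y * (1 - \<rho> u)"
          using ny r by (intro mult_right_mono) auto
        also have "\<dots> \<le> m * y"
        proof -
          have "0 \<le> m * y" using ny by linarith
          then show ?thesis using r by (intro mult_left_le) auto
        qed
        finally show ?thesis .
      qed
      ultimately have "real (card {j\<in>J. p j \<le> \<rho> u}) < n * \<rho> u - m * s"
        using ms by (simp add: algebra_simps)
      then show ?thesis using u(1) by blast
    qed
    show ?thesis
    proof (cases "m * s < n")
      case False
      have "\<not> ?A p" for p
      proof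
        assume "?A p"
        from A[OF this] obtain u :: real where u: "u \<in> X" "real (card {j\<in>J. p j \<le> \<rho> u}) < n * \<rho> u - m * s"
          by blast
        have "real n * \<rho> u \<le> real n * 1" using x[OF u(1)] by (intro mult_left_mono) auto
        then show False using u(2) False by simp
      qed
      then show ?thesis by simp
    next
      case lt: True
      have "0 < m * s" using s m by simp
      with lt have n0: "0 < real n" by linarith
      let ?s = "m * s / n"
      have s': "0 < ?s" "?s < 1" using lt n0 \<open>0 < m * s\<close> by auto
      have "(E (\<lambda>p. of_bool (?A p)) :: real) \<le>
          E (\<lambda>p. of_bool (\<exists>x\<in>\<rho> ` X. real (card {j\<in>J. p j \<le> x}) \<le> card J * (x - ?s)))"
      proof (rule expectation_mono_det[OF det])
        show "determined_by J (\<rho> ` X)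
            (\<lambda>p. of_bool (\<exists>x\<in>\<rho> ` X. real (card {j\<in>J. p j \<le> x}) \<le> card J * (x - ?s)) :: real)"
          by (intro determined_by_comp[of _ _ _ of_bool] determined_by_bex
              determined_by_comp[of _ _ _ "\<lambda>c. real c \<le> _"] determined_by_card) auto
        show "of_bool (?A p) \<le>
            (of_bool (\<exists>x\<in>\<rho> ` X. real (card {j\<in>J. p j \<le> x}) \<le> card J * (x - ?s)) :: real)" for p
        proof -
          have "card J * (x - ?s) = n * x - m * s" for x :: real using n0 J by (simp add: algebra_simps)
          then show ?thesis using A[of p] by (auto intro: less_imp_le)
        qed
      qed (use J X in auto)
      also have "\<dots> \<le> exp (- (2 * card J * ?s\<^sup>2 / (1 + ?s)))"
        using x X by (intro empirical_lower_tail J s') auto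
      also have "\<dots> \<le> exp (- 2 * m * s\<^sup>2 * \<theta>)"
      proof -
        obtain u where "u \<in> X" using True by blast
        then have "m * \<delta> \<le> m * (1 - \<zeta>)" using x(3) by (intro mult_left_mono) auto
        moreover have "real n \<le> m * \<zeta> + m * y" using ny by linarith
        ultimately have "n + m * s \<le> m" unfolding ms by (simp add: algebra_simps)
        then have "\<theta> * (n + m * s) \<le> 1 * real m"
          using \<theta> \<open>0 < m * s\<close> by (intro mult_mono) auto
        then have "m * s\<^sup>2 * (\<theta> * (n + m * s)) \<le> m * s\<^sup>2 * m" by (intro mult_left_mono) auto
        moreover have "n * ?s\<^sup>2 / (1 + ?s) = m * s\<^sup>2 * m / (n + m * s)"
          using n0 \<open>0 < m * s\<close> by (simp add: divide_simps power2_eq_square)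
        ultimately have "m * s\<^sup>2 * \<theta> \<le> n * ?s\<^sup>2 / (1 + ?s)"
          using n0 \<open>0 < m * s\<close> by (simp add: pos_le_divide_eq mult.assoc)
        then show ?thesis using J by simp
      qed
      finally show ?thesis using s by (simp add: s_def[symmetric] max_def)
    qed
  qed
qed

end

section \<open>Step-up-down procedures in terms of counts\<close>

definition count_le :: "nat \<Rightarrow> (nat \<Rightarrow> real) \<Rightarrow> real \<Rightarrow> nat" where
  "count_le m p x = card {i. i < m \<and> p i \<le> x}"

lemma mono_count_le: "mono (count_le m p)"
  unfolding count_le_def by (intro monoI card_mono) auto

lemma count_le_le: "count_le m p x \<le> m"
  using card_mono[of "{..<m}" "{i. i < m \<and> p i \<le> x}"] by (auto simp: count_le_def)

lemma ord_stat_le_iff: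
  assumes "1 \<le> k" "k \<le> m"
  shows "ord_stat m p k \<le> x \<longleftrightarrow> k \<le> count_le m p x"
proof -
  define xs where "xs = sort (map p [0..<m])"
  have len: "length xs = m" and sorted: "sorted xs" by (simp_all add: xs_def)
  have "count_le m p x = length (filter (\<lambda>y. y \<le> x) (map p [0..<m]))"
    by (auto simp: count_le_def length_filter_conv_card intro!: arg_cong[where f = card])
  also have "\<dots> = length (filter (\<lambda>y. y \<le> x) xs)"
    by (metis xs_def filter_sort length_sort)
  also have "\<dots> = card {i. i < m \<and> xs ! i \<le> x}"
    by (simp add: length_filter_conv_card len)
  finally have cnt: "count_le m p x = card {i. i < m \<and> xs ! i \<le> x}" .
  have "xs ! (k - 1) \<le> x \<longleftrightarrow> k \<le> card {i. i < m \<and> xs ! i \<le> x}"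
  proof
    assume le: "xs ! (k - 1) \<le> x"
    have "xs ! i \<le> x" if "i < k" for i
      using sorted_nth_mono[OF sorted, of i "k - 1"] that assms len le by linarith
    then have "card {..<k} \<le> card {i. i < m \<and> xs ! i \<le> x}"
      using assms by (intro card_mono) auto
    then show "k \<le> card {i. i < m \<and> xs ! i \<le> x}" by simp
  next
    assume le: "k \<le> card {i. i < m \<and> xs ! i \<le> x}"
    show "xs ! (k - 1) \<le> x"
    proof (rule ccontr)
      assume gt: "\<not> xs ! (k - 1) \<le> x"
      have "i < k - 1" if "i < m" "xs ! i \<le> x" for i
      proof (rule ccontr)
        assume "\<not> i < k - 1"
        then have "xs ! (k - 1) \<le> xs ! i"
          using sorted_nth_mono[OF sorted, of "k - 1" i] that len by simp
        with that gt show False by simp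
      qed
      then have "card {i. i < m \<and> xs ! i \<le> x} \<le> card {..<k - 1}"
        by (intro card_mono) auto
      with le assms show False by simp
    qed
  qed
  then show ?thesis using assms cnt by (simp add: ord_stat_def xs_def)
qed

definition sud :: "nat \<Rightarrow> nat \<Rightarrow> (nat \<Rightarrow> nat) \<Rightarrow> nat" where
  "sud m lam c = (if lam \<le> c lam then Max {k \<in> {lam..m}. \<forall>k'\<in>{lam..k}. k' \<le> c k'}
     else Max {k \<in> {0..lam}. k \<le> c k})"

lemma sud_khat_eq_sud:
  assumes "lam \<in> {1..m}"
  shows "sud_khat m lam t p = sud m lam (\<lambda>k. count_le m p (thr t k))"
proof -
  have *: "ord_stat m p k \<le> thr t k \<longleftrightarrow> k \<le> count_le m p (thr t k)" if "k \<le> m" for k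
    using that by (cases "k = 0") (auto simp: ord_stat_le_iff, simp add: ord_stat_def thr_def)
  have "{k \<in> {lam..m}. \<forall>k'\<in>{lam..k}. ord_stat m p k' \<le> thr t k'} =
      {k \<in> {lam..m}. \<forall>k'\<in>{lam..k}. k' \<le> count_le m p (thr t k')}"
    using * by auto
  moreover have "{k \<in> {0..lam}. ord_stat m p k \<le> thr t k} =
      {k \<in> {0..lam}. k \<le> count_le m p (thr t k)}"
    using * assms by auto
  ultimately show ?thesis
    using *[of lam] assms by (simp add: sud_khat_def sud_def)
qed

lemma sud_up:
  assumes "lam \<le> m" "lam \<le> c lam"
  shows "lam \<le> sud m lam c" "sud m lam c \<le> m"
    "\<And>k. lam \<le> k \<Longrightarrow> k \<le> sud m lam c \<Longrightarrow> k \<le> c k"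
    "sud m lam c < m \<Longrightarrow> c (Suc (sud m lam c)) \<le> sud m lam c"
proof -
  let ?S = "{k \<in> {lam..m}. \<forall>k'\<in>{lam..k}. k' \<le> c k'}"
  have K: "sud m lam c = Max ?S" using assms by (simp add: sud_def)
  have "lam \<in> ?S" using assms by auto
  then have "Max ?S \<in> ?S" by (intro Max_in) auto
  then have mem: "sud m lam c \<in> ?S" unfolding K .
  have ge: "k \<le> sud m lam c" if "k \<in> ?S" for k
    unfolding K by (rule Max_ge[OF _ that]) simp
  from mem show le: "lam \<le> sud m lam c" "sud m lam c \<le> m" by auto
  show *: "k \<le> c k" if "lam \<le> k" "k \<le> sud m lam c" for k using mem that by auto
  assume lt: "sud m lam c < m"
  show "c (Suc (sud m lam c)) \<le> sud m lam c"
  proof (rule ccontr)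
    assume "\<not> ?thesis"
    then have "Suc (sud m lam c) \<in> ?S"
      using lt le * by (auto simp: le_Suc_eq)
    then have "Suc (sud m lam c) \<le> sud m lam c" by (rule ge)
    then show False by simp
  qed
qed

lemma sud_down:
  assumes "c lam < lam"
  shows "sud m lam c < lam" "sud m lam c \<le> c (sud m lam c)"
    "\<And>k. sud m lam c < k \<Longrightarrow> k \<le> lam \<Longrightarrow> c k < k"
proof -
  let ?S = "{k \<in> {0..lam}. k \<le> c k}"
  have K: "sud m lam c = Max ?S" using assms by (simp add: sud_def)
  have "0 \<in> ?S" by auto
  then have "Max ?S \<in> ?S" by (intro Max_in) auto
  then have mem: "sud m lam c \<in> ?S" unfolding K .
  have ge: "k \<le> sud m lam c" if "k \<in> ?S" for k
    unfolding K by (rule Max_ge[OF _ that]) simp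
  from mem show "sud m lam c \<le> c (sud m lam c)" by simp
  show "sud m lam c < lam" using mem assms by (auto simp: le_less)
  show "c k < k" if "sud m lam c < k" "k \<le> lam" for k
  proof (rule ccontr)
    assume "\<not> c k < k"
    then have "k \<in> ?S" using that by auto
    then have "k \<le> sud m lam c" by (rule ge)
    then show False using that by simp
  qed
qed

lemma sud_le: "lam \<le> m \<Longrightarrow> sud m lam c \<le> m"
  using sud_up[of lam m c] sud_down[of c lam m] by (meson le_trans less_imp_le not_le)

lemma sud_mono:
  assumes lam: "lam \<le> m" and le: "\<And>k. k \<le> m \<Longrightarrow> c k \<le> c' k"
  shows "sud m lam c \<le> sud m lam c'"
proof (cases "lam \<le> c lam")
  case True
  then have True': "lam \<le> c' lam" using le[of lam] lam by simp
  show ?thesis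
  proof (rule ccontr)
    assume "\<not> ?thesis"
    then have lt: "sud m lam c' < sud m lam c" by simp
    moreover have "sud m lam c \<le> m" using sud_le[OF lam] .
    ultimately have "c' (Suc (sud m lam c')) \<le> sud m lam c'" using sud_up(4)[of lam m c', OF lam True'] by simp
    moreover have "Suc (sud m lam c') \<le> c (Suc (sud m lam c'))"
      using sud_up(1)[of lam m c', OF lam True'] lt by (intro sud_up(3)[of lam m c, OF lam True]) auto
    ultimately show False using le[of "Suc (sud m lam c')"] lt sud_le[OF lam, of c] by simp
  qed
next
  case False
  then have down: "c lam < lam" by simp
  show ?thesis
  proof (cases "lam \<le> c' lam")
    case True
    then show ?thesis using sud_up(1)[of lam m c', OF lam] sud_down(1)[of c, OF down, of m] by simp
  next
    case False
    then have down': "c' lam < lam" by simp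
    show ?thesis
    proof (rule ccontr)
      assume "\<not> ?thesis"
      then have "c' (sud m lam c) < sud m lam c"
        using sud_down(1)[of c, OF down, of m] by (intro sud_down(3)[of c', OF down', of m]) auto
      then show False using sud_down(2)[of c, OF down, of m] le[of "sud m lam c"] sud_le[OF lam, of c] by simp
    qed
  qed
qed

lemma sud_cong:
  "lam \<le> m \<Longrightarrow> (\<And>k. k \<le> m \<Longrightarrow> c k = c' k) \<Longrightarrow> sud m lam c = sud m lam c'"
  by (intro antisym sud_mono) auto

lemma sud_fixpoint:
  assumes lam: "lam \<le> m" and c: "\<And>k. Suc k \<le> m \<Longrightarrow> c k \<le> c (Suc k)" "\<And>k. c k \<le> m"
  shows "c (sud m lam c) = sud m lam c"
proof (cases "lam \<le> c lam")
  case True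
  let ?K = "sud m lam c"
  have "?K \<le> c ?K" using sud_up(1,3)[of lam m c, OF lam True] by simp
  moreover have "c ?K \<le> ?K"
  proof (cases "?K < m")
    case lt: True
    have "c ?K \<le> c (Suc ?K)" using lt by (intro c(1)) simp
    then show ?thesis using sud_up(4)[of lam m c, OF lam True lt] by simp
  next
    case False
    then show ?thesis using c(2)[of ?K] by simp
  qed
  ultimately show ?thesis by simp
next
  case False
  then have down: "c lam < lam" by simp
  let ?K = "sud m lam c"
  have "c ?K \<le> c (Suc ?K)"
    using sud_down(1)[of c, OF down, of m] lam by (intro c(1)) simp
  also have "c (Suc ?K) < Suc ?K"
    using sud_down(1)[of c, OF down, of m] by (intro sud_down(3)[of c, OF down, of m]) auto
  finally show ?thesis using sud_down(2)[of c, OF down, of m] by simp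
qed

lemma sud_eq_if_eq_above:
  assumes lam: "lam \<le> m" and le: "\<And>k. k \<le> m \<Longrightarrow> c k \<le> c' k"
    and eq: "\<And>k. sud m lam c \<le> k \<Longrightarrow> k \<le> m \<Longrightarrow> c' k = c k"
  shows "sud m lam c' = sud m lam c"
proof (rule ccontr)
  assume "\<not> ?thesis"
  then have lt: "sud m lam c < sud m lam c'" using sud_mono[of lam m c c'] lam le by force
  show False
  proof (cases "lam \<le> c lam")
    case True
    then have up': "lam \<le> c' lam" using le[of lam] lam by simp
    have Km: "sud m lam c < m" using lt sud_le[OF lam, of c'] by simp
    have "Suc (sud m lam c) \<le> c' (Suc (sud m lam c))"
      using sud_up(1)[of lam m c, OF lam True] lt by (intro sud_up(3)[of lam m c', OF lam up']) auto
    also have "\<dots> = c (Suc (sud m lam c))" using Km by (intro eq) auto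
    finally show False using sud_up(4)[of lam m c, OF lam True Km] by simp
  next
    case False
    then have down: "c lam < lam" by simp
    have "c' lam = c lam" using sud_down(1)[of c, OF down, of m] lam by (intro eq) auto
    with down have down': "c' lam < lam" by simp
    have "sud m lam c' \<le> c' (sud m lam c')" by (rule sud_down(2)[of c', OF down'])
    also have "\<dots> = c (sud m lam c')" using lt sud_le[OF lam] by (intro eq) auto
    finally show False
      using sud_down(3)[of c, OF down, of m, OF lt] sud_down(1)[of c', OF down', of m] by simp
  qed
qed

lemma sud_eq_if_eq_at_down:
  assumes lam: "lam \<le> m" and le: "\<And>k. k \<le> m \<Longrightarrow> c k \<le> c' k"
    and down: "sud m lam c' < lam" and eq: "c (sud m lam c') = c' (sud m lam c')"
  shows "sud m lam c = sud m lam c'"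
proof -
  have down': "c' lam < lam"
    using sud_up(1)[of lam m c'] lam down by (meson not_le)
  then have down'': "c lam < lam" using le[of lam] lam by simp
  have "\<not> sud m lam c < sud m lam c'"
    using sud_down(3)[of c, OF down'', of m "sud m lam c'"] sud_down(2)[of c', OF down', of m] eq down by auto
  then show ?thesis using sud_mono[of lam m c c'] lam le by force
qed

lemma U_fun_up:
  assumes cont: "continuous_on {0..1} (\<lambda>u. G (\<rho> u))" and G1: "G (\<rho> 1) \<le> 1"
    and \<tau>: "0 \<le> \<tau>" "\<tau> \<le> 1" and up: "\<tau> \<le> G (\<rho> \<tau>)"
  defines "U \<equiv> U_fun \<rho> \<tau> G"
  shows "\<tau> \<le> U" "U \<le> 1" "G (\<rho> U) \<le> U" "\<And>u. \<tau> \<le> u \<Longrightarrow> u \<le> U \<Longrightarrow> u \<le> G (\<rho> u)"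
    "\<And>u. \<tau> \<le> u \<Longrightarrow> u \<le> 1 \<Longrightarrow> G (\<rho> u) \<le> u \<Longrightarrow> U \<le> u"
proof -
  let ?S = "{u \<in> {\<tau>..1}. G (\<rho> u) \<le> u}"
  have U: "U = Inf ?S" using up by (simp add: U_def U_fun_def)
  have cont': "continuous_on {a..b} (\<lambda>u. G (\<rho> u))" if "0 \<le> a" "b \<le> 1" for a b
    by (rule continuous_on_subset[OF cont]) (use that in auto)
  have "closed ?S"
    using \<tau> by (intro continuous_on_closed_Collect_le cont' continuous_on_id closed_atLeastAtMost) auto
  moreover have "?S \<noteq> {}" using G1 \<tau> by auto
  moreover have bdd: "bdd_below ?S" by (rule bdd_belowI[of _ \<tau>]) auto
  ultimately have "U \<in> ?S" unfolding U by (intro closed_contains_Inf) auto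
  then show mem: "\<tau> \<le> U" "U \<le> 1" "G (\<rho> U) \<le> U" by auto
  show least: "U \<le> u" if "\<tau> \<le> u" "u \<le> 1" "G (\<rho> u) \<le> u" for u
    unfolding U by (intro cInf_lower bdd) (use that in auto)
  show "u \<le> G (\<rho> u)" if u: "\<tau> \<le> u" "u \<le> U" for u
  proof (rule ccontr)
    assume neg: "\<not> ?thesis"
    have "\<exists>v\<ge>\<tau>. v \<le> u \<and> G (\<rho> v) - v = 0"
      using u mem neg up \<tau> by (intro IVT2' continuous_intros cont') auto
    then obtain v where v: "\<tau> \<le> v" "v \<le> u" "G (\<rho> v) = v" by auto
    then have "U \<le> v" using u mem by (intro least) auto
    with v u have "v = u" by simp
    with v neg show False by simp
  qed
qed

lemma U_fun_down:
  assumes cont: "continuous_on {0..1} (\<lambda>u. G (\<rho> u))" and G0: "0 \<le> G (\<rho> 0)"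
    and \<tau>: "0 \<le> \<tau>" "\<tau> \<le> 1" and down: "G (\<rho> \<tau>) < \<tau>"
  defines "U \<equiv> U_fun \<rho> \<tau> G"
  shows "0 \<le> U" "U \<le> \<tau>" "U \<le> G (\<rho> U)"
    "\<And>u. 0 \<le> u \<Longrightarrow> u \<le> \<tau> \<Longrightarrow> u \<le> G (\<rho> u) \<Longrightarrow> u \<le> U"
proof -
  let ?S = "{u \<in> {0..\<tau>}. u \<le> G (\<rho> u)}"
  have U: "U = Sup ?S" using down by (simp add: U_def U_fun_def)
  have cont': "continuous_on {0..\<tau>} (\<lambda>u. G (\<rho> u))"
    by (rule continuous_on_subset[OF cont]) (use \<tau> in auto)
  have "closed ?S"
    using \<tau> by (intro continuous_on_closed_Collect_le cont' continuous_on_id closed_atLeastAtMost)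
  moreover have "?S \<noteq> {}" using G0 \<tau> by auto
  moreover have bdd: "bdd_above ?S" by (rule bdd_aboveI[of _ \<tau>]) auto
  ultimately have "U \<in> ?S" unfolding U by (intro closed_contains_Sup) auto
  then show "0 \<le> U" "U \<le> \<tau>" "U \<le> G (\<rho> U)" by auto
  show "u \<le> U" if "0 \<le> u" "u \<le> \<tau>" "u \<le> G (\<rho> u)" for u
    unfolding U by (intro cSup_upper bdd) (use that in auto)
qed

lemma U_fun_mono:
  assumes cont: "continuous_on {0..1} (\<lambda>u. G (\<rho> u))" "continuous_on {0..1} (\<lambda>u. H (\<rho> u))"
    and H1: "H (\<rho> 1) \<le> 1" and G0: "0 \<le> G (\<rho> 0)"
    and \<tau>: "0 \<le> \<tau>" "\<tau> \<le> 1" and le: "\<And>u. 0 \<le> u \<Longrightarrow> u \<le> 1 \<Longrightarrow> G (\<rho> u) \<le> H (\<rho> u)"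
  shows "U_fun \<rho> \<tau> G \<le> U_fun \<rho> \<tau> H"
proof -
  have G1: "G (\<rho> 1) \<le> 1" and H0: "0 \<le> H (\<rho> 0)"
    using le[of 1] le[of 0] H1 G0 by simp_all
  note upG = U_fun_up[of G \<rho>, OF cont(1) G1 \<tau>] and upH = U_fun_up[of H \<rho>, OF cont(2) H1 \<tau>]
  note dnG = U_fun_down[of G \<rho>, OF cont(1) G0 \<tau>] and dnH = U_fun_down[of H \<rho>, OF cont(2) H0 \<tau>]
  show ?thesis
  proof (cases "\<tau> \<le> H (\<rho> \<tau>)")
    case up: True
    show ?thesis
    proof (cases "\<tau> \<le> G (\<rho> \<tau>)")
      case True
      show ?thesis
        using upH(1-3)[OF up] le[of "U_fun \<rho> \<tau> H"] \<tau> by (intro upG(5)[OF True]) auto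
    next
      case False
      then show ?thesis using dnG(2) upH(1)[OF up] by simp
    qed
  next
    case False
    then have dH: "H (\<rho> \<tau>) < \<tau>" and dG: "G (\<rho> \<tau>) < \<tau>" using le[OF \<tau>] by simp_all
    show ?thesis
      using dnG(1-3)[OF dG] le[of "U_fun \<rho> \<tau> G"] \<tau> by (intro dnH(4)[OF dH]) auto
  qed
qed

locale sud_setup =
  fixes m lam :: nat and \<rho> :: "real \<Rightarrow> real"
  assumes rho_cont: "continuous_on {0..1} \<rho>"
    and rho_mono: "mono_on {0..1} \<rho>"
    and rho_range: "\<rho> ` {0..1} \<subseteq> {0..1}"
    and rho_ratio: "mono_on {0<..1} (\<lambda>x. \<rho> x / x)"
    and lam: "lam \<in> {1..m}"
begin

lemma m_pos: "0 < real m" and lam_le: "lam \<le> m" and lam_pos: "1 \<le> lam"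
  using lam by auto

lemma tau: "0 \<le> real lam / real m" "real lam / real m \<le> 1" "0 < real lam / real m"
  using m_pos lam_le lam_pos by auto

lemma frac_in: "k \<le> m \<Longrightarrow> 0 \<le> real k / real m \<and> real k / real m \<le> 1"
  using m_pos by auto

lemma rho_bounds: "0 \<le> x \<Longrightarrow> x \<le> 1 \<Longrightarrow> 0 \<le> \<rho> x \<and> \<rho> x \<le> 1"
  using rho_range by (force simp: image_subset_iff)

lemma rho_monoD: "0 \<le> x \<Longrightarrow> x \<le> y \<Longrightarrow> y \<le> 1 \<Longrightarrow> \<rho> x \<le> \<rho> y"
  using rho_mono by (auto simp: mono_on_def)

lemma rho_ratioD: "0 < x \<Longrightarrow> x \<le> y \<Longrightarrow> y \<le> 1 \<Longrightarrow> \<rho> x / x \<le> \<rho> y / y"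
  using rho_ratio by (auto simp: mono_on_def)

lemma rho_le: "0 \<le> x \<Longrightarrow> x \<le> 1 \<Longrightarrow> \<rho> x \<le> x"
proof -
  have pos: "\<rho> x \<le> x" if "0 < x" "x \<le> 1" for x
  proof -
    have "\<rho> x / x \<le> \<rho> 1 / 1" using that by (intro rho_ratioD) auto
    also have "\<dots> \<le> 1" using rho_bounds[of 1] by simp
    finally have "\<rho> x / x \<le> 1" .
    then show ?thesis using that by simp
  qed
  show "\<rho> x \<le> x" if "0 \<le> x" "x \<le> 1"
  proof (cases "x = 0")
    case True
    have "\<rho> 0 \<le> 0 + e" if "0 < e" for e
      using rho_monoD[of 0 "min e 1"] pos[of "min e 1"] that by simp
    then show ?thesis using True field_le_epsilon by blast
  qed (use pos that in auto)
qed

lemma rho_0: "\<rho> 0 = 0"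
  using rho_le[of 0] rho_bounds[of 0] by simp

lemma rho_ratio_le: "0 < x \<Longrightarrow> x \<le> 1 \<Longrightarrow> \<rho> x / x \<le> 1"
  using rho_le[of x] by simp

abbreviation level :: "nat \<Rightarrow> real" where "level k \<equiv> \<rho> (real k / real m)"

lemma level_mono: "j \<le> k \<Longrightarrow> k \<le> m \<Longrightarrow> level j \<le> level k"
  using m_pos by (intro rho_monoD) (auto simp: divide_right_mono)

lemma level_nonneg: "k \<le> m \<Longrightarrow> 0 \<le> level k" and level_le_1: "k \<le> m \<Longrightarrow> level k \<le> 1"
  using rho_bounds frac_in by blast+

lemma cont_min: "continuous_on {0..1} (\<lambda>u. min (G_DU \<zeta> (\<rho> u) + \<delta>) 1)"
  unfolding G_DU_def by (intro continuous_intros rho_cont)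

lemma cont_max: "continuous_on {0..1} (\<lambda>u. max (G_DU \<zeta> (\<rho> u) - \<delta>) 0)"
  unfolding G_DU_def by (intro continuous_intros rho_cont)

lemma G_DU_rho_1: "0 \<le> \<zeta> \<Longrightarrow> G_DU \<zeta> (\<rho> 1) \<le> 1"
  using rho_bounds[of 1] mult_left_le[of "\<rho> 1" \<zeta>] by (auto simp: G_DU_def)

lemma u_plus_bounds:
  assumes "0 \<le> \<zeta>" "\<zeta> \<le> 1" "0 \<le> \<delta>"
  shows "0 \<le> u_plus \<rho> m lam \<zeta> \<delta>" "u_plus \<rho> m lam \<zeta> \<delta> \<le> 1"
proof -
  let ?G = "\<lambda>x. min (G_DU \<zeta> x + \<delta>) 1"
  have G0: "0 \<le> ?G (\<rho> 0)" and G1: "?G (\<rho> 1) \<le> 1"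
    using assms by (auto simp: G_DU_def rho_0)
  show "0 \<le> u_plus \<rho> m lam \<zeta> \<delta>" "u_plus \<rho> m lam \<zeta> \<delta> \<le> 1"
    using U_fun_up(1,2)[of ?G \<rho>, OF cont_min G1 tau(1,2)]
      U_fun_down(1,2)[of ?G \<rho>, OF cont_min G0 tau(1,2)] tau
    unfolding u_plus_def by (meson not_le order_trans)+
qed

lemma u_minus_bounds:
  assumes "0 \<le> \<zeta>" "0 \<le> \<delta>"
  shows "0 \<le> u_minus \<rho> m lam \<zeta> \<delta>" "u_minus \<rho> m lam \<zeta> \<delta> \<le> 1"
proof -
  let ?G = "\<lambda>x. max (G_DU \<zeta> x - \<delta>) 0"
  have G0: "0 \<le> ?G (\<rho> 0)" and G1: "?G (\<rho> 1) \<le> 1"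
    using assms G_DU_rho_1[of \<zeta>] by auto
  show "0 \<le> u_minus \<rho> m lam \<zeta> \<delta>" "u_minus \<rho> m lam \<zeta> \<delta> \<le> 1"
    using U_fun_up(1,2)[of ?G \<rho>, OF cont_max G1 tau(1,2)]
      U_fun_down(1,2)[of ?G \<rho>, OF cont_max G0 tau(1,2)] tau
    unfolding u_minus_def by (meson not_le order_trans)+
qed

lemma u_minus_le_u_plus:
  assumes "0 \<le> \<zeta>" "\<zeta> \<le> 1" "0 \<le> \<delta>"
  shows "u_minus \<rho> m lam \<zeta> \<delta> \<le> u_plus \<rho> m lam \<zeta> \<delta>"
proof -
  have le: "max (G_DU \<zeta> (\<rho> u) - \<delta>) 0 \<le> min (G_DU \<zeta> (\<rho> u) + \<delta>) 1" if "0 \<le> u" "u \<le> 1" for u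
  proof -
    have "0 \<le> \<zeta> * \<rho> u" "\<zeta> * \<rho> u \<le> \<zeta>"
      using rho_bounds[OF that] assms by (auto intro: mult_left_le)
    then show ?thesis using assms by (auto simp: G_DU_def)
  qed
  show ?thesis
    unfolding u_plus_def u_minus_def
    by (rule U_fun_mono[where \<rho> = \<rho>]) (use le cont_min cont_max tau in auto)
qed

lemma sud_le_u_plus:
  shows "\<exists>x\<in>{0..1}. \<forall>C. mono C \<longrightarrow> lam \<le> sud m lam (\<lambda>k. C (level k)) \<longrightarrow>
    real (C x) \<le> m * (G_DU \<zeta> x + \<delta>) - 1 \<longrightarrow>
    real (sud m lam (\<lambda>k. C (level k))) \<le> m * u_plus \<rho> m lam \<zeta> \<delta>"
proof -
  let ?G = "\<lambda>x. min (G_DU \<zeta> x + \<delta>) 1" and ?\<tau> = "real lam / real m"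
  let ?u = "u_plus \<rho> m lam \<zeta> \<delta>"
  have G1: "?G (\<rho> 1) \<le> 1" by simp
  show ?thesis
  proof (cases "?\<tau> \<le> ?G (\<rho> ?\<tau>)")
    case True
    note up = U_fun_up[of ?G \<rho>, OF cont_min G1 tau(1,2) True, folded u_plus_def]
    show ?thesis
    proof (intro bexI[of _ "\<rho> ?u"] allI impI)
      show "\<rho> ?u \<in> {0..1}" using rho_bounds[of ?u] up(1,2) tau by auto
      fix C :: "real \<Rightarrow> nat"
      let ?K = "sud m lam (\<lambda>k. C (level k))"
      assume C: "mono C" and "lam \<le> ?K" and small: "real (C (\<rho> ?u)) \<le> m * (G_DU \<zeta> (\<rho> ?u) + \<delta>) - 1"
      show "real ?K \<le> m * ?u"
      proof (rule ccontr)
        assume "\<not> ?thesis"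
        then have gt: "m * ?u < real ?K" by simp
        have Km: "?K \<le> m" by (rule sud_le[OF lam_le])
        have "?u < 1"
        proof (rule ccontr)
          assume "\<not> ?u < 1"
          then have "real m * 1 \<le> m * ?u" by (intro mult_left_mono) auto
          then show False using gt Km by simp
        qed
        define k where "k = nat \<lfloor>m * ?u\<rfloor>"
        have mu: "real lam \<le> m * ?u" using up(1) m_pos by (simp add: field_simps)
        then have k: "real k \<le> m * ?u" "m * ?u < real k + 1" unfolding k_def by linarith+
        have "lam \<le> k" using mu unfolding k_def by linarith
        have "k \<le> ?K" using k gt by linarith
        have "lam \<le> C (level lam)"
          using sud_down(1)[of "\<lambda>k. C (level k)" lam m] \<open>lam \<le> ?K\<close> by (meson not_le)
        then have "k \<le> C (level k)"
          using sud_up(3)[of lam m "\<lambda>k. C (level k)" k] \<open>lam \<le> k\<close> \<open>k \<le> ?K\<close> lam_le by blast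
        also have "level k \<le> \<rho> ?u"
          using k up(2) m_pos by (intro rho_monoD) (auto simp: field_simps)
        then have "C (level k) \<le> C (\<rho> ?u)" by (rule monoD[OF C])
        finally have "m * ?u < C (\<rho> ?u) + 1" using k by linarith
        also have "\<dots> \<le> m * (G_DU \<zeta> (\<rho> ?u) + \<delta>)" using small by simp
        finally have "?u < G_DU \<zeta> (\<rho> ?u) + \<delta>" using m_pos by simp
        then show False using up(3) \<open>?u < 1\<close> by simp
      qed
    qed
  next
    case False
    show ?thesis
    proof (intro bexI[of _ "\<rho> ?\<tau>"] allI impI)
      show "\<rho> ?\<tau> \<in> {0..1}" using rho_bounds[of ?\<tau>] tau by auto
      fix C :: "real \<Rightarrow> nat"
      let ?K = "sud m lam (\<lambda>k. C (level k))"
      assume C: "mono C" and K: "lam \<le> ?K" and small: "real (C (\<rho> ?\<tau>)) \<le> m * (G_DU \<zeta> (\<rho> ?\<tau>) + \<delta>) - 1"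
      have "lam \<le> C (level lam)"
        using sud_down(1)[of "\<lambda>k. C (level k)" lam m] K by (meson not_le)
      then have "real lam < m * (G_DU \<zeta> (\<rho> ?\<tau>) + \<delta>)" using small by linarith
      then have "?\<tau> < G_DU \<zeta> (\<rho> ?\<tau>) + \<delta>" using m_pos by (simp add: field_simps)
      then have False using False tau by (simp add: min_def split: if_splits)
      then show "real ?K \<le> m * ?u" ..
    qed
  qed
qed

lemma sud_ge_u_minus:
  assumes "0 \<le> \<zeta>" "0 \<le> \<delta>"
  shows "\<exists>X :: real set. finite X \<and> (\<forall>u\<in>X. 0 < u \<and> u \<le> 1 \<and> u \<le> G_DU \<zeta> (\<rho> u) - \<delta>) \<and>
    (\<forall>C. mono C \<longrightarrow> real (sud m lam (\<lambda>k. C (level k))) < m * u_minus \<rho> m lam \<zeta> \<delta> \<longrightarrow>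
      (\<exists>u\<in>X. real (C (\<rho> u)) < m * u))"
proof -
  let ?G = "\<lambda>x. max (G_DU \<zeta> x - \<delta>) 0" and ?\<tau> = "real lam / real m"
  let ?u = "u_minus \<rho> m lam \<zeta> \<delta>"
  have G0: "0 \<le> ?G (\<rho> 0)" and G1: "?G (\<rho> 1) \<le> 1"
    using assms G_DU_rho_1[of \<zeta>] by auto
  show ?thesis
  proof (cases "?\<tau> \<le> ?G (\<rho> ?\<tau>)")
    case True
    note up = U_fun_up[of ?G \<rho>, OF cont_max G1 tau(1,2) True, folded u_minus_def]
    define X where "X = (\<lambda>k. min (real k / m) ?u) ` {lam..m}"
    have X: "\<tau>' \<ge> ?\<tau> \<and> \<tau>' \<le> ?u" if "\<tau>' \<in> X" for \<tau>'
      using that up(1) m_pos by (auto simp: X_def divide_right_mono)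
    show ?thesis
    proof (intro exI[of _ X] conjI ballI allI impI)
      show "finite X" by (simp add: X_def)
    next
      fix u assume "u \<in> X"
      note u = X[OF this]
      then show "0 < u" "u \<le> 1" using tau(3) up(2) by linarith+
      then show "u \<le> G_DU \<zeta> (\<rho> u) - \<delta>" using up(4)[of u] u by simp
    next
      fix C :: "real \<Rightarrow> nat"
      let ?c = "\<lambda>k. C (level k)"
      let ?K = "sud m lam ?c"
      assume C: "mono C" and lt: "real ?K < m * ?u"
      have "real m * ?u \<le> real m * 1" using up(2) by (intro mult_left_mono) auto
      then have Km: "?K < m" using lt by simp
      have "\<exists>k. lam \<le> k \<and> k \<le> m \<and> ?c k < k \<and> real k - 1 < m * ?u"
      proof (cases "lam \<le> ?c lam")
        case True
        show ?thesis
          using sud_up(1,4)[of lam m ?c, OF lam_le True] Km lt by (intro exI[of _ "Suc ?K"]) auto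
      next
        case False
        have "real lam \<le> m * ?u" using up(1) m_pos by (simp add: field_simps)
        then show ?thesis using False lam_le by (intro exI[of _ lam]) auto
      qed
      then obtain k where k: "lam \<le> k" "k \<le> m" "?c k < k" "real k - 1 < m * ?u" by blast
      let ?v = "min (real k / m) ?u"
      have "0 \<le> ?u" using tau(1) up(1) by (rule order_trans)
      then have "\<rho> ?v \<le> level k" using frac_in[OF k(2)] by (intro rho_monoD) auto
      then have "C (\<rho> ?v) \<le> C (level k)" by (rule monoD[OF C])
      then have "real (C (\<rho> ?v)) \<le> real k - 1" using k(3) by linarith
      also have "\<dots> < m * ?v" using k(4) m_pos by (auto simp: min_def)
      finally show "\<exists>u\<in>X. real (C (\<rho> u)) < m * u" using k by (auto simp: X_def)
    qed
  next
    case False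
    then have down: "?G (\<rho> ?\<tau>) < ?\<tau>" by (simp only: not_le)
    note dn = U_fun_down[of ?G \<rho>, OF cont_max G0 tau(1,2) down, folded u_minus_def]
    show ?thesis
    proof (intro exI[of _ "{?u} \<inter> {0<..}"] conjI ballI allI impI)
      show "finite ({?u} \<inter> {0<..})" by simp
    next
      fix u assume u: "u \<in> {?u} \<inter> {0<..}"
      then show "0 < u" "u \<le> 1" using dn(2) tau by auto
      then show "u \<le> G_DU \<zeta> (\<rho> u) - \<delta>" using dn(3) u by auto
    next
      fix C :: "real \<Rightarrow> nat"
      let ?c = "\<lambda>k. C (level k)"
      let ?K = "sud m lam ?c"
      assume C: "mono C" and lt: "real ?K < m * ?u"
      have "0 < m * ?u" using lt by (rule le_less_trans[rotated]) simp
      then have pos: "0 < ?u" using m_pos by (simp add: zero_less_mult_iff)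
      have mu: "m * ?u \<le> real lam" using dn(2) m_pos by (simp add: field_simps)
      then have "?K < lam" using lt by linarith
      then have down: "?c lam < lam" using sud_up(1)[of lam m ?c, OF lam_le] by (meson not_le)
      define k where "k = nat \<lceil>m * ?u\<rceil>"
      have k: "m * ?u \<le> real k" "real k < m * ?u + 1" using pos m_pos \<open>0 < m * ?u\<close> unfolding k_def by linarith+
      have "?K < k" "k \<le> lam" using k lt mu by linarith+
      then have ck: "?c k < k" by (rule sud_down(3)[of ?c, OF down])
      have "k \<le> m" using \<open>k \<le> lam\<close> lam_le by simp
      have "\<rho> ?u \<le> level k" using k pos m_pos frac_in[OF \<open>k \<le> m\<close>] by (intro rho_monoD) (auto simp: field_simps)
      then have "C (\<rho> ?u) \<le> C (level k)" by (rule monoD[OF C])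
      then have "real (C (\<rho> ?u)) \<le> real k - 1" using ck by linarith
      then have "real (C (\<rho> ?u)) < m * ?u" using k by linarith
      then show "\<exists>u\<in>{?u} \<inter> {0<..}. real (C (\<rho> u)) < m * u" using pos by auto
    qed
  qed
qed

end

section \<open>Reduction to the null p-values\<close>

context sud_setup
begin

definition khat :: "(nat \<Rightarrow> real) \<Rightarrow> nat" where
  "khat p = sud m lam (\<lambda>k. count_le m p (level k))"

definition levels :: "real set" where
  "levels = level ` {..m}"

lemma finite_levels: "finite levels"
  by (simp add: levels_def)

lemma thr_level: "thr level k = level k"
  by (simp add: thr_def rho_0)

lemma sud_khat_level: "sud_khat m lam level p = khat p"
  by (simp add: sud_khat_eq_sud[OF lam] thr_level khat_def)

lemma khat_le: "khat p \<le> m"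
  unfolding khat_def by (rule sud_le[OF lam_le])

lemma count_khat: "count_le m p (level (khat p)) = khat p"
  unfolding khat_def
  by (rule sud_fixpoint[OF lam_le, where c = "\<lambda>k. count_le m p (level k)"])
     (auto intro!: monoD[OF mono_count_le] level_mono count_le_le simp del: of_nat_Suc)

lemma khat_mono:
  assumes "\<And>j x. j < m \<Longrightarrow> 0 \<le> x \<Longrightarrow> x \<le> 1 \<Longrightarrow> p j \<le> x \<Longrightarrow> q j \<le> x"
  shows "khat p \<le> khat q"
  unfolding khat_def
proof (rule sud_mono[OF lam_le])
  fix k assume k: "k \<le> m"
  show "count_le m p (level k) \<le> count_le m q (level k)"
    unfolding count_le_def
    by (rule card_mono) (use assms level_nonneg[OF k] level_le_1[OF k] in auto)
qed

lemma det_khat: "determined_by {..<m} levels khat"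
proof (rule determined_byI)
  fix p q :: "nat \<Rightarrow> real"
  assume eq: "\<And>i x. i \<in> {..<m} \<Longrightarrow> x \<in> levels \<Longrightarrow> p i \<le> x \<longleftrightarrow> q i \<le> x"
  show "khat p = khat q"
    unfolding khat_def
  proof (rule sud_cong[OF lam_le])
    fix k assume "k \<le> m"
    then have "level k \<in> levels" by (auto simp: levels_def)
    then have "{i. i < m \<and> p i \<le> level k} = {i. i < m \<and> q i \<le> level k}"
      using eq by auto
    then show "count_le m p (level k) = count_le m q (level k)"
      by (simp add: count_le_def)
  qed
qed

lemma count_upd_0:
  assumes "k \<le> m" "p i \<le> level k"
  shows "count_le m (p(i := 0)) (level k) = count_le m p (level k)"
proof -
  have "{j. j < m \<and> (p(i := 0)) j \<le> level k} = {j. j < m \<and> p j \<le> level k}"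
    using assms level_nonneg[OF assms(1)] by auto
  then show ?thesis by (simp add: count_le_def)
qed

lemma count_le_upd_0: "k \<le> m \<Longrightarrow> count_le m p (level k) \<le> count_le m (p(i := 0)) (level k)"
  using level_nonneg[of k] unfolding count_le_def by (intro card_mono) auto

lemma khat_upd_0:
  assumes "p i \<le> level (khat p)"
  shows "khat (p(i := 0)) = khat p"
  unfolding khat_def
proof (rule sud_eq_if_eq_above[OF lam_le])
  fix k assume k: "sud m lam (\<lambda>k. count_le m p (level k)) \<le> k" "k \<le> m"
  then have "level (khat p) \<le> level k" by (intro level_mono) (auto simp: khat_def)
  with assms have "p i \<le> level k" by simp
  then show "count_le m (p(i := 0)) (level k) = count_le m p (level k)"
    by (rule count_upd_0[OF k(2)])
qed (rule count_le_upd_0)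

lemma khat_upd_0_down:
  assumes "khat (p(i := 0)) < lam" "p i \<le> level (khat (p(i := 0)))"
  shows "khat p = khat (p(i := 0))"
  unfolding khat_def
proof (rule sud_eq_if_eq_at_down[OF lam_le])
  show "count_le m p (level (sud m lam (\<lambda>k. count_le m (p(i := 0)) (level k)))) =
    count_le m (p(i := 0)) (level (sud m lam (\<lambda>k. count_le m (p(i := 0)) (level k))))"
    using assms(2) khat_le[of "p(i := 0)"] unfolding khat_def by (rule count_upd_0[symmetric, rotated])
qed (use assms(1) in \<open>auto simp: khat_def intro: count_le_upd_0\<close>)

lemma khat_upd_0_pos:
  assumes "i < m"
  shows "1 \<le> khat (p(i := 0))"
proof -
  have "i \<in> {j. j < m \<and> (p(i := 0)) j \<le> level (khat (p(i := 0)))}"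
    using assms level_nonneg[OF khat_le] by simp
  then have "0 < card {j. j < m \<and> (p(i := 0)) j \<le> level (khat (p(i := 0)))}"
    by (subst card_gt_0_iff) auto
  then show ?thesis
    using count_khat[of "p(i := 0)"] by (simp add: count_le_def)
qed

lemma level_ratio_mono:
  assumes "1 \<le> j" "j \<le> k" "k \<le> m"
  shows "level j / real j \<le> level k / real k"
proof -
  have "level j / (real j / m) \<le> level k / (real k / m)"
    using assms m_pos by (intro rho_ratioD) (auto simp: divide_right_mono)
  then have "real m * (level j / real j) \<le> real m * (level k / real k)" by (simp add: mult.commute)
  then show ?thesis using m_pos by (simp only: mult_le_cancel_left_pos)
qed

definition rej :: "nat \<Rightarrow> (nat \<Rightarrow> real) \<Rightarrow> real" where
  "rej i p = of_bool (p i \<le> level (khat p)) / max (real (khat p)) 1"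

lemma rej_nonneg: "0 \<le> rej i p"
  by (simp add: rej_def)

lemma FDP_eq_sum_rej:
  assumes "m0 \<le> m"
  shows "FDP m m0 lam level p = (\<Sum>i<m0. rej i p)"
proof -
  have "real (card {i. i < m0 \<and> p i \<le> level (khat p)}) = (\<Sum>i<m0. of_bool (p i \<le> level (khat p)))"
    by (simp add: of_bool_def sum.If_cases Int_def lessThan_def)
  moreover have "real (max (card {i. i < m \<and> p i \<le> level (khat p)}) 1) = max (real (khat p)) 1"
    using count_khat[of p] by (simp add: count_le_def of_nat_max)
  ultimately show ?thesis
    unfolding FDP_def Let_def sud_khat_level thr_level rej_def by (simp only: sum_divide_distrib)
qed

lemma det_rej:
  assumes "i < m"
  shows "determined_by {..<m} levels (rej i)"
proof (rule determined_byI)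
  fix p q :: "nat \<Rightarrow> real"
  assume eq: "\<And>i x. i \<in> {..<m} \<Longrightarrow> x \<in> levels \<Longrightarrow> p i \<le> x \<longleftrightarrow> q i \<le> x"
  have k: "khat p = khat q" by (rule determined_byD[OF det_khat]) (rule eq)
  have "level (khat q) \<in> levels" using khat_le by (auto simp: levels_def)
  then show "rej i p = rej i q" using eq[of i] assms by (simp add: rej_def k)
qed

text \<open>The value \<open>0\<close> makes a p-value count at every threshold; below, \<open>2\<close> makes it count at none.\<close>
definition nulls :: "nat \<Rightarrow> (nat \<Rightarrow> real) \<Rightarrow> nat \<Rightarrow> real" where
  "nulls m0 p = (\<lambda>j. if j < m0 then p j else 0)"

lemma det_nulls:
  assumes "determined_by {..<m} X f"
  shows "determined_by {..<m0} X (\<lambda>p. f (nulls m0 p))"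
  by (rule determined_byI) (auto intro!: determined_byD[OF assms] simp: nulls_def)

lemma nulls_upd: "i < m0 \<Longrightarrow> nulls m0 (p(i := y)) = (nulls m0 p)(i := y)"
  by (auto simp: nulls_def)

lemma count_nulls_upd_0:
  assumes "i < m0" "m0 \<le> m" "0 \<le> x"
  shows "count_le m ((nulls m0 p)(i := 0)) x = m - (m0 - 1) + card {j\<in>{..<m0} - {i}. p j \<le> x}"
proof -
  have "{j. j < m \<and> ((nulls m0 p)(i := 0)) j \<le> x} = insert i {m0..<m} \<union> {j\<in>{..<m0} - {i}. p j \<le> x}"
    using assms by (auto simp: nulls_def)
  moreover have "card (insert i {m0..<m} \<union> {j\<in>{..<m0} - {i}. p j \<le> x}) =
      card (insert i {m0..<m}) + card {j\<in>{..<m0} - {i}. p j \<le> x}"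
    using assms by (intro card_Un_disjoint) auto
  ultimately show ?thesis using assms by (simp add: count_le_def)
qed

lemma count_nulls_upd_2:
  assumes "i < m0" "m0 \<le> m" "0 \<le> x" "x \<le> 1"
  shows "count_le m ((nulls m0 p)(i := 2)) x = m - 1 - (m0 - 1) + card {j\<in>{..<m0} - {i}. p j \<le> x}"
proof -
  have "{j. j < m \<and> ((nulls m0 p)(i := 2)) j \<le> x} = {m0..<m} \<union> {j\<in>{..<m0} - {i}. p j \<le> x}"
    using assms by (auto simp: nulls_def)
  moreover have "card ({m0..<m} \<union> {j\<in>{..<m0} - {i}. p j \<le> x}) =
      card {m0..<m} + card {j\<in>{..<m0} - {i}. p j \<le> x}"
    using assms by (intro card_Un_disjoint) auto
  ultimately show ?thesis using assms by (simp add: count_le_def)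
qed

lemma real_product_FM: "F \<in> cdf_class \<Longrightarrow> real_product {..<m} (\<lambda>i. if i < m0 then unif else law F)"
  by (rule real_product.intro) (simp_all add: prob_space_unif prob_space_law sets_law)

lemma FM_expectation_nulls:
  fixes f :: "(nat \<Rightarrow> real) \<Rightarrow> real"
  assumes F: "F \<in> cdf_class" and f: "determined_by {..<m0} X f" "finite X" and m0: "m0 \<le> m"
  shows "integral\<^sup>L (FM m m0 F) f = integral\<^sup>L (PiM {..<m0} (\<lambda>_. unif)) f"
proof -
  interpret real_product "{..<m}" "\<lambda>i. if i < m0 then unif else law F" by (rule real_product_FM[OF F])
  have "integral\<^sup>L (FM m m0 F) f = integral\<^sup>L (PiM {..<m0} (\<lambda>i. if i < m0 then unif else law F)) f"
    unfolding FM_def by (rule expectation_restrict[OF f]) (use m0 in auto)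
  also have "PiM {..<m0} (\<lambda>i. if i < m0 then unif else law F) = PiM {..<m0} (\<lambda>_. unif)"
    by (rule PiM_cong) auto
  finally show ?thesis .
qed

lemma FDR_FM_eq_sum:
  assumes F: "F \<in> cdf_class" and m0: "m0 \<le> m"
  shows "FDR_FM m m0 lam level F = (\<Sum>i<m0. integral\<^sup>L (FM m m0 F) (rej i))"
proof -
  interpret real_product "{..<m}" "\<lambda>i. if i < m0 then unif else law F" by (rule real_product_FM[OF F])
  show ?thesis
    unfolding FDR_FM_def FDP_eq_sum_rej[OF m0] FM_def
    by (rule Bochner_Integration.integral_sum)
       (use m0 in \<open>auto intro!: integrable_det[OF det_rej finite_levels]\<close>)
qed

lemma FDR_FM_one:
  assumes m0: "m0 \<le> m"
  shows "FDR_FM m m0 lam level (\<lambda>_. 1) =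
    (\<Sum>i<m0. integral\<^sup>L (PiM {..<m0} (\<lambda>_. unif)) (\<lambda>p. rej i (nulls m0 p)))"
  unfolding FDR_FM_eq_sum[OF one_cdf_class m0]
proof (rule sum.cong[OF refl])
  fix i assume "i \<in> {..<m0}"
  then have i: "i < m0" "i < m" using m0 by auto
  interpret real_product "{..<m}" "\<lambda>i. if i < m0 then unif else law (\<lambda>_. 1)"
    by (rule real_product_FM[OF one_cdf_class])
  have det: "determined_by {..<m0} levels (\<lambda>p. rej i (nulls m0 p))"
    by (rule det_nulls[OF det_rej[OF i(2)]])
  have "AE p in FM m m0 (\<lambda>_. 1). \<forall>j\<in>{m0..<m}. p j \<le> 0"
  proof (rule AE_finite_allI)
    fix j assume j: "j \<in> {m0..<m}"
    show "AE p in FM m m0 (\<lambda>_. 1). p j \<le> 0"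
      unfolding FM_def
      by (rule AE_PiM_component) (use j AE_law_one prob_M in auto)
  qed simp
  then have "AE p in FM m m0 (\<lambda>_. 1). rej i p = rej i (nulls m0 p)"
  proof eventually_elim
    case (elim p)
    show ?case
    proof (rule determined_byD[OF det_rej[OF i(2)]])
      fix j x assume j: "j \<in> {..<m}" and "x \<in> levels"
      then have "0 \<le> x" using level_nonneg by (auto simp: levels_def)
      then show "p j \<le> x \<longleftrightarrow> nulls m0 p j \<le> x"
        using j elim by (cases "j < m0") (auto simp: nulls_def intro: order_trans)
    qed
  qed
  then have "integral\<^sup>L (FM m m0 (\<lambda>_. 1)) (rej i) = integral\<^sup>L (FM m m0 (\<lambda>_. 1)) (\<lambda>p. rej i (nulls m0 p))"
    unfolding FM_def
    by (intro integral_cong_AE measurable_det[OF det_rej[OF i(2)] finite_levels]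
        measurable_det[OF det finite_levels]) (use m0 in auto)
  also have "\<dots> = integral\<^sup>L (PiM {..<m0} (\<lambda>_. unif)) (\<lambda>p. rej i (nulls m0 p))"
    by (rule FM_expectation_nulls[OF one_cdf_class det finite_levels m0])
  finally show "integral\<^sup>L (FM m m0 (\<lambda>_. 1)) (rej i) =
      integral\<^sup>L (PiM {..<m0} (\<lambda>_. unif)) (\<lambda>p. rej i (nulls m0 p))" .
qed

definition rej_max :: "nat \<Rightarrow> nat \<Rightarrow> (nat \<Rightarrow> real) \<Rightarrow> real" where
  "rej_max m0 i p = of_bool (p i \<le> level (khat ((nulls m0 p)(i := 0)))) / real (khat ((nulls m0 p)(i := 0)))"

lemma det_khat_nulls_upd: "determined_by {..<m0} levels (\<lambda>p. khat ((nulls m0 p)(i := y)))"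
  by (rule determined_byI) (auto intro!: determined_byD[OF det_khat] simp: nulls_def)

lemma det_rej_max:
  assumes "i < m0"
  shows "determined_by {..<m0} levels (rej_max m0 i)"
proof (rule determined_byI)
  fix p q :: "nat \<Rightarrow> real"
  assume eq: "\<And>i x. i \<in> {..<m0} \<Longrightarrow> x \<in> levels \<Longrightarrow> p i \<le> x \<longleftrightarrow> q i \<le> x"
  have k: "khat ((nulls m0 p)(i := 0)) = khat ((nulls m0 q)(i := 0))"
    by (rule determined_byD[OF det_khat_nulls_upd]) (rule eq)
  have "level (khat ((nulls m0 q)(i := 0))) \<in> levels" using khat_le by (auto simp: levels_def)
  then show "rej_max m0 i p = rej_max m0 i q" using eq[of i] assms by (simp add: rej_max_def k)
qed

lemma FM_rej_le:
  assumes F: "F \<in> cdf_class" and m0: "m0 \<le> m" and i: "i < m0"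
  shows "integral\<^sup>L (FM m m0 F) (rej i) \<le> integral\<^sup>L (PiM {..<m0} (\<lambda>_. unif)) (rej_max m0 i)"
proof -
  interpret real_product "{..<m}" "\<lambda>i. if i < m0 then unif else law F" by (rule real_product_FM[OF F])
  have im: "i < m" using i m0 by simp
  have detT: "determined_by {..<m} levels (rej_max m0 i)"
    by (rule determined_by_mono[OF det_rej_max[OF i]]) (use m0 in auto)
  have "E (rej i) \<le> E (rej_max m0 i)"
  proof (rule expectation_mono_coordinate[OF det_rej[OF im] detT finite_levels])
    show "i \<in> {..<m}" using im by simp
    fix p :: "nat \<Rightarrow> real"
    let ?k = "khat (p(i := 0))" and ?K = "khat ((nulls m0 p)(i := 0))"
    have k: "1 \<le> ?k" "1 \<le> ?K" by (rule khat_upd_0_pos[OF im])+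
    have kK: "?k \<le> ?K" by (rule khat_mono) (auto simp: nulls_def)
    have lv: "0 \<le> level (khat q)" "level (khat q) \<le> 1" for q
      using level_nonneg level_le_1 khat_le by auto
    have U: "(if i < m0 then unif else law F) = unif" using i by simp
    have "(\<integral>y. rej i (p(i := y)) \<partial>unif) \<le> (\<integral>y. of_bool (y \<le> level ?k) / real ?k \<partial>unif)"
    proof (rule integral_mono)
      show "integrable unif (\<lambda>y. rej i (p(i := y)))"
        using integrable_coordinate[OF det_rej[OF im] finite_levels, of i p] unfolding U .
      show "integrable unif (\<lambda>y. of_bool (y \<le> level ?k) / real ?k)"
        by (intro integrable_divide integrable_unif_le)
      fix y
      show "rej i (p(i := y)) \<le> of_bool (y \<le> level ?k) / real ?k"
      proof (cases "y \<le> level (khat (p(i := y)))")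
        case True
        then have "?k = khat (p(i := y))" using khat_upd_0[of "p(i := y)" i] by simp
        then show ?thesis using True k by (simp add: rej_def max_def)
      qed (simp add: rej_def)
    qed
    also have "\<dots> = level ?k / real ?k"
      using lv[of "p(i := 0)"] by (simp add: integral_unif_le)
    also have "\<dots> \<le> level ?K / real ?K"
      by (rule level_ratio_mono[OF k(1) kK khat_le])
    also have "\<dots> = (\<integral>y. of_bool (y \<le> level ?K) / real ?K \<partial>unif)"
      using lv[of "(nulls m0 p)(i := 0)"] by (simp add: integral_unif_le)
    also have "\<dots> = (\<integral>y. rej_max m0 i (p(i := y)) \<partial>unif)"
      using i by (simp add: rej_max_def nulls_upd)
    finally show "(\<integral>y. rej i (p(i := y)) \<partial>(if i < m0 then unif else law F)) \<le>
        (\<integral>y. rej_max m0 i (p(i := y)) \<partial>(if i < m0 then unif else law F))"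
      unfolding U .
  qed
  then show ?thesis
    using FM_expectation_nulls[OF F det_rej_max[OF i] finite_levels m0] by (simp add: FM_def)
qed

end

context sud_setup
begin

lemma level_gap_bound:
  fixes A B :: bool
  assumes K: "K2 \<le> K1" "K1 \<le> m" "1 \<le> K1"
    and \<zeta>: "0 \<le> \<zeta>" "\<zeta> \<le> 1" and \<delta>: "0 \<le> \<delta>"
    and A: "lam \<le> K1 \<Longrightarrow> \<not> A \<Longrightarrow> real K1 \<le> m * u_plus \<rho> m lam \<zeta> \<delta>"
    and B: "\<not> B \<Longrightarrow> m * u_minus \<rho> m lam \<zeta> \<delta> \<le> real K2"
  shows "of_bool (lam \<le> K1) * (level K1 - level K2) / real K1 \<le>
    ((\<rho> (u_plus \<rho> m lam \<zeta> \<delta>) - \<rho> (u_minus \<rho> m lam \<zeta> \<delta>)) / u_plus \<rho> m lam \<zeta> \<delta>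
      + of_bool A + of_bool B) / m"
proof -
  let ?u = "u_plus \<rho> m lam \<zeta> \<delta>" and ?l = "u_minus \<rho> m lam \<zeta> \<delta>"
  have u: "0 \<le> ?u" "?u \<le> 1" "0 \<le> ?l" "?l \<le> 1" "?l \<le> ?u"
    using u_plus_bounds[OF \<zeta> \<delta>] u_minus_bounds[OF \<zeta>(1) \<delta>] u_minus_le_u_plus[OF \<zeta> \<delta>] by auto
  have C: "0 \<le> (\<rho> ?u - \<rho> ?l) / ?u"
    using u rho_monoD[of ?l ?u] by (intro divide_nonneg_nonneg) auto
  have K1: "0 < real K1 / m" "real K1 / m \<le> 1" using K m_pos by auto
  have K2: "0 \<le> real K2 / m" "real K2 / m \<le> 1" using K m_pos by auto
  have l2: "0 \<le> level K2" using rho_bounds K2 by simp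
  have eq: "of_bool (lam \<le> K1) * (level K1 - level K2) / real K1 =
      of_bool (lam \<le> K1) * ((level K1 - level K2) / (real K1 / m)) / m"
    using m_pos by simp
  have "of_bool (lam \<le> K1) * ((level K1 - level K2) / (real K1 / m)) \<le>
      (\<rho> ?u - \<rho> ?l) / ?u + of_bool A + of_bool B"
  proof (cases "lam \<le> K1")
    case lam: True
    show ?thesis
    proof (cases "A \<or> B")
      case True
      have "(level K1 - level K2) / (real K1 / m) \<le> level K1 / (real K1 / m)"
        using K1 l2 by (intro divide_right_mono) auto
      also have "\<dots> \<le> 1" by (rule rho_ratio_le[OF K1])
      also have "\<dots> \<le> of_bool A + of_bool B" using True by auto
      finally show ?thesis using C lam by simp
    next
      case False
      have v: "real K1 / m \<le> ?u" using A[OF lam] False m_pos by (simp add: field_simps)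
      have w: "?l \<le> real K2 / m" using B False m_pos by (simp add: field_simps)
      have "\<rho> ?l \<le> level K2" using u w K2 by (intro rho_monoD) auto
      then have "\<rho> ?l / ?u \<le> level K2 / (real K1 / m)"
        using v K1 l2 by (intro frac_le) auto
      moreover have "level K1 / (real K1 / m) \<le> \<rho> ?u / ?u"
        using v K1 u by (intro rho_ratioD) auto
      ultimately show ?thesis using lam False by (simp add: diff_divide_distrib del: divide_divide_eq_right)
    qed
  next
    case False
    then show ?thesis using C by simp
  qed
  then have "of_bool (lam \<le> K1) * ((level K1 - level K2) / (real K1 / m)) / m \<le>
      ((\<rho> ?u - \<rho> ?l) / ?u + of_bool A + of_bool B) / m"
    using m_pos by (intro divide_right_mono) auto
  then show ?thesis unfolding eq .
qed

lemma rej_max_pointwise: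
  assumes i: "i < m0" "m0 \<le> m"
  defines "K1 \<equiv> (\<lambda>p. khat ((nulls m0 p)(i := 0)))" and "K2 \<equiv> (\<lambda>p. khat ((nulls m0 p)(i := 2)))"
  shows "rej_max m0 i p \<le> rej i (nulls m0 p) +
    of_bool (lam \<le> K1 p) * (of_bool (p i \<le> level (K1 p)) - of_bool (p i \<le> level (K2 p))) / real (K1 p)"
proof -
  let ?q = "nulls m0 p"
  have im: "i < m" and qi: "?q i = p i" using i by (auto simp: nulls_def)
  have K1: "1 \<le> K1 p" "K1 p \<le> m" unfolding K1_def using khat_upd_0_pos[OF im] khat_le by auto
  have le: "K2 p \<le> khat ?q" "khat ?q \<le> K1 p"
    unfolding K1_def K2_def by (rule khat_mono; simp split: if_splits)+
  have lv: "level (K2 p) \<le> level (khat ?q)" "level (khat ?q) \<le> level (K1 p)"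
    using le K1 khat_le by (auto intro!: level_mono)
  consider "level (K1 p) < p i" | "p i \<le> level (khat ?q)" | "level (khat ?q) < p i" "p i \<le> level (K1 p)"
    by linarith
  then show ?thesis
  proof cases
    case 1
    then show ?thesis using lv rej_nonneg[of i ?q] by (simp add: rej_max_def K1_def)
  next
    case 2
    then have "K1 p = khat ?q" unfolding K1_def using khat_upd_0[of ?q i] qi by simp
    then have "rej_max m0 i p = rej i ?q" using 2 K1 qi by (simp add: rej_max_def rej_def K1_def)
    moreover have "0 \<le> (of_bool (p i \<le> level (K1 p)) - of_bool (p i \<le> level (K2 p)) :: real)"
      using lv by auto
    ultimately show ?thesis by simp
  next
    case 3
    have "lam \<le> K1 p"
    proof (rule ccontr)
      assume "\<not> lam \<le> K1 p"
      then have "khat ?q = K1 p"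
        unfolding K1_def using 3 qi by (intro khat_upd_0_down) (auto simp: K1_def)
      with 3 show False by simp
    qed
    then show ?thesis using 3 lv rej_nonneg[of i ?q] by (simp add: rej_max_def K1_def)
  qed
qed

lemma expectation_rej_max_le:
  assumes i: "i < m0" and m0: "m0 \<le> m" and \<zeta>: "0 < \<zeta>" "\<zeta> < 1" and \<delta>: "0 < \<delta>"
    and y: "\<bar>(real m0 - 1) / m - \<zeta>\<bar> \<le> y"
  shows "integral\<^sup>L (PiM {..<m0} (\<lambda>_. unif)) (rej_max m0 i) \<le>
    integral\<^sup>L (PiM {..<m0} (\<lambda>_. unif)) (\<lambda>p. rej i (nulls m0 p)) + eps_bound \<rho> lam \<delta> m \<zeta> y / m"
proof -
  interpret unif_product "{..<m0}" by unfold_locales simp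
  let ?J = "{..<m0} - {i}" and ?n = "m0 - 1"
  define K1 where "K1 = (\<lambda>p. khat ((nulls m0 p)(i := 0)))"
  define K2 where "K2 = (\<lambda>p. khat ((nulls m0 p)(i := 2)))"
  define gap where "gap = (\<rho> (u_plus \<rho> m lam \<zeta> \<delta>) - \<rho> (u_minus \<rho> m lam \<zeta> \<delta>)) / u_plus \<rho> m lam \<zeta> \<delta>"
  define e where "e = exp (- 2 * real m * (max 0 (\<delta> - y - 1 / real m))\<^sup>2 * max 0 (1 - y / \<zeta>))"
  have im: "i < m" using i m0 by simp
  have J: "?J \<subseteq> {..<m0}" "card ?J = ?n" and n: "?n < m" using i m0 by auto
  have y': "\<bar>real ?n / m - \<zeta>\<bar> \<le> y" using y i by (simp add: of_nat_diff)
  have "0 \<le> y" using y by linarith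
  then have \<theta>: "0 \<le> max 0 (1 - y / \<zeta>)" "max 0 (1 - y / \<zeta>) \<le> 1" using \<zeta> by auto
  have \<rho>: "0 \<le> \<rho> u \<and> \<rho> u \<le> u" if "0 \<le> u" "u \<le> 1" for u
    using rho_bounds[OF that] rho_le[OF that] by auto
  obtain x where x01: "x \<in> {0..1}" and x_prop: "\<forall>C. mono C \<longrightarrow> lam \<le> sud m lam (\<lambda>k. C (level k)) \<longrightarrow>
      real (C x) \<le> m * (G_DU \<zeta> x + \<delta>) - 1 \<longrightarrow>
      real (sud m lam (\<lambda>k. C (level k))) \<le> m * u_plus \<rho> m lam \<zeta> \<delta>"
    using sud_le_u_plus[of \<zeta> \<delta>] by (rule bexE)
  then have x: "0 \<le> x" "x \<le> 1" by simp_all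
  obtain X :: "real set" where X: "finite X" "\<forall>u\<in>X. 0 < u \<and> u \<le> 1 \<and> u \<le> G_DU \<zeta> (\<rho> u) - \<delta>"
    and X_prop: "\<forall>C. mono C \<longrightarrow> real (sud m lam (\<lambda>k. C (level k))) < m * u_minus \<rho> m lam \<zeta> \<delta> \<longrightarrow>
      (\<exists>u\<in>X. real (C (\<rho> u)) < m * u)"
    using sud_ge_u_minus[OF less_imp_le[OF \<zeta>(1)] less_imp_le[OF \<delta>]] by (elim exE conjE)
  note X = X(1) X(2)[rule_format]
  define A where "A = (\<lambda>p. m * (G_DU \<zeta> x + \<delta>) - 1 < real (m - ?n + card {j\<in>?J. p j \<le> x}))"
  define B where "B = (\<lambda>p. \<exists>u\<in>X. real (m - 1 - ?n + card {j\<in>?J. p j \<le> \<rho> u}) < m * u)"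
  let ?Y = "levels \<union> insert x (\<rho> ` X)"
  have finY: "finite ?Y" using X finite_levels by simp
  have EA: "E (\<lambda>p. of_bool (A p)) \<le> e"
    unfolding A_def e_def by (rule upper_event_bound[OF J n x y' \<theta>])
  have EB: "E (\<lambda>p. of_bool (B p)) \<le> e"
    unfolding B_def e_def by (rule lower_event_bound[OF J n \<zeta>(2) \<delta> X \<rho> y' \<theta>])
  have detA: "determined_by {..<m0} ?Y A"
    unfolding A_def
    by (intro determined_by_comp[of _ _ _ "\<lambda>c. _ < real (_ + c)"] determined_by_card) auto
  have detB: "determined_by {..<m0} ?Y B"
    unfolding B_def
    by (intro determined_by_bex determined_by_comp[of _ _ _ "\<lambda>c. real (_ + c) < _"] determined_by_card) auto
  have detS: "determined_by {..<m0} ?Y (\<lambda>p. rej i (nulls m0 p))"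
    by (rule determined_by_mono[OF det_nulls[OF det_rej[OF im]]]) auto
  have detT: "determined_by {..<m0} ?Y (rej_max m0 i)"
    by (rule determined_by_mono[OF det_rej_max[OF i]]) auto
  define H where "H = (\<lambda>p. (gap + of_bool (A p) + of_bool (B p)) / m)"
  have detH: "determined_by {..<m0} ?Y H"
    unfolding H_def by (rule determined_by_comp2[OF detA detB])
  have detSH: "determined_by {..<m0} ?Y (\<lambda>p. rej i (nulls m0 p) + H p)"
    by (rule determined_by_comp2[OF detS detH])
  have lv: "0 \<le> level (khat q)" "level (khat q) \<le> 1" for q
    using level_nonneg level_le_1 khat_le by auto
  have "E (rej_max m0 i) \<le> E (\<lambda>p. rej i (nulls m0 p) + H p)"
  proof (rule expectation_mono_coordinate[OF detT detSH finY])
    show "i \<in> {..<m0}" using i by simp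
    fix p :: "nat \<Rightarrow> real"
    have upd: "K1 (p(i := y)) = K1 p" "K2 (p(i := y)) = K2 p" "H (p(i := y)) = H p" for y
    proof -
      show "K1 (p(i := y)) = K1 p" "K2 (p(i := y)) = K2 p"
        using i by (simp_all add: K1_def K2_def nulls_upd)
      have "{j\<in>?J. (p(i := y)) j \<le> z} = {j\<in>?J. p j \<le> z}" for z by auto
      then show "H (p(i := y)) = H p" unfolding H_def A_def B_def by simp
    qed
    have K1: "1 \<le> K1 p" "K1 p \<le> m" unfolding K1_def using khat_upd_0_pos[OF im] khat_le by auto
    have K21: "K2 p \<le> K1 p"
      unfolding K1_def K2_def by (rule khat_mono) (simp split: if_splits)
    let ?g = "\<lambda>y. of_bool (lam \<le> K1 p) * (of_bool (y \<le> level (K1 p)) - of_bool (y \<le> level (K2 p))) / real (K1 p)"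
    have int_g: "integrable unif ?g"
      by (intro integrable_divide integrable_mult_right Bochner_Integration.integrable_diff integrable_unif_le)
    have int_S: "integrable unif (\<lambda>y. rej i (nulls m0 (p(i := y))))"
      by (rule integrable_coordinate[OF detS finY])
    have "(\<integral>y. ?g y \<partial>unif) = of_bool (lam \<le> K1 p) * (level (K1 p) - level (K2 p)) / real (K1 p)"
      using lv[of "(nulls m0 p)(i := 0)"] lv[of "(nulls m0 p)(i := 2)"]
      by (simp add: integral_unif_le integrable_unif_le K1_def K2_def)
    also have "\<dots> \<le> H p"
      unfolding H_def gap_def
    proof (rule level_gap_bound[OF K21 K1(2,1)])
      assume "lam \<le> K1 p" "\<not> A p"
      then show "real (K1 p) \<le> m * u_plus \<rho> m lam \<zeta> \<delta>"
        using x_prop[rule_format, OF mono_count_le, of m "(nulls m0 p)(i := 0)"]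
          count_nulls_upd_0[OF i m0 x(1), of p]
        by (simp add: K1_def khat_def A_def)
    next
      assume nB: "\<not> B p"
      show "m * u_minus \<rho> m lam \<zeta> \<delta> \<le> real (K2 p)"
      proof (rule ccontr)
        assume "\<not> ?thesis"
        then have "\<exists>u\<in>X. real (count_le m ((nulls m0 p)(i := 2)) (\<rho> u)) < m * u"
          using X_prop[rule_format, OF mono_count_le, of m "(nulls m0 p)(i := 2)"]
          unfolding K2_def khat_def not_le by blast
        then obtain u :: real where u: "u \<in> X" "real (count_le m ((nulls m0 p)(i := 2)) (\<rho> u)) < m * u"
          by blast
        have "0 \<le> \<rho> u" "\<rho> u \<le> 1" using X(2)[OF u(1)] rho_bounds[of u] by auto
        then have "B p"
          using u count_nulls_upd_2[OF i m0, of "\<rho> u" p] unfolding B_def by auto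
        with nB show False by simp
      qed
    qed (use \<zeta> \<delta> in auto)
    finally have g: "(\<integral>y. ?g y \<partial>unif) \<le> H p" .
    have "(\<integral>y. rej_max m0 i (p(i := y)) \<partial>unif) \<le> (\<integral>y. rej i (nulls m0 (p(i := y))) + ?g y \<partial>unif)"
    proof (rule integral_mono)
      show "integrable unif (\<lambda>y. rej_max m0 i (p(i := y)))"
        by (rule integrable_coordinate[OF detT finY])
      show "integrable unif (\<lambda>y. rej i (nulls m0 (p(i := y))) + ?g y)"
        by (intro Bochner_Integration.integrable_add int_S int_g)
      show "rej_max m0 i (p(i := y)) \<le> rej i (nulls m0 (p(i := y))) + ?g y" for y
        using rej_max_pointwise[OF i m0, of "p(i := y)", folded K1_def K2_def] upd[of y]
        by (simp add: K1_def K2_def)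
    qed
    also have "\<dots> = (\<integral>y. rej i (nulls m0 (p(i := y))) \<partial>unif) + (\<integral>y. ?g y \<partial>unif)"
      by (rule Bochner_Integration.integral_add[OF int_S int_g])
    also have "\<dots> \<le> (\<integral>y. rej i (nulls m0 (p(i := y))) \<partial>unif) + (\<integral>y. H p \<partial>unif)"
      using g by (simp add: prob_space.prob_space[OF prob_space_unif])
    also have "\<dots> = (\<integral>y. rej i (nulls m0 (p(i := y))) + H (p(i := y)) \<partial>unif)"
      unfolding upd(3)
      by (rule Bochner_Integration.integral_add[symmetric, OF int_S])
         (rule finite_measure.integrable_const[OF prob_space.finite_measure[OF prob_space_unif]])
    finally show "(\<integral>y. rej_max m0 i (p(i := y)) \<partial>unif) \<le>
        (\<integral>y. rej i (nulls m0 (p(i := y))) + H (p(i := y)) \<partial>unif)" .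
  qed
  also have "\<dots> = E (\<lambda>p. rej i (nulls m0 p)) + E H"
    by (intro Bochner_Integration.integral_add integrable_det[OF detS finY] integrable_det[OF detH finY]) auto
  also have "E H = (gap + E (\<lambda>p. of_bool (A p)) + E (\<lambda>p. of_bool (B p))) / m"
  proof -
    have "integrable (PiM {..<m0} (\<lambda>_. unif)) (\<lambda>p. of_bool (A p) :: real)"
      "integrable (PiM {..<m0} (\<lambda>_. unif)) (\<lambda>p. of_bool (B p) :: real)"
      by (rule integrable_det[OF determined_by_comp[OF detA] finY order_refl],
          rule integrable_det[OF determined_by_comp[OF detB] finY order_refl])
    then show ?thesis
      unfolding H_def by (simp add: P.prob_space)
  qed
  also have "\<dots> \<le> (gap + 4 / (1 - \<zeta>) * e) / m"
  proof -
    have "2 * e \<le> 4 / (1 - \<zeta>) * e"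
      using \<zeta> by (intro mult_right_mono) (auto simp: e_def field_simps)
    then show ?thesis using EA EB m_pos by (intro divide_right_mono) auto
  qed
  finally show ?thesis
    by (simp add: eps_bound_def gap_def e_def)
qed

lemma FDR_FM_le:
  assumes F: "F \<in> cdf_class" and m0: "m0 \<le> m" and \<zeta>: "0 < \<zeta>" "\<zeta> < 1" and \<delta>: "0 < \<delta>"
    and y: "\<bar>(real m0 - 1) / m - \<zeta>\<bar> \<le> y"
  shows "FDR_FM m m0 lam level F \<le> FDR_FM m m0 lam level (\<lambda>_. 1) + real m0 / m * eps_bound \<rho> lam \<delta> m \<zeta> y"
proof -
  let ?E = "integral\<^sup>L (PiM {..<m0} (\<lambda>_. unif))"
  have "FDR_FM m m0 lam level F \<le> (\<Sum>i<m0. ?E (rej_max m0 i))"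
    unfolding FDR_FM_eq_sum[OF F m0] by (intro sum_mono FM_rej_le F m0) auto
  also have "\<dots> \<le> (\<Sum>i<m0. ?E (\<lambda>p. rej i (nulls m0 p)) + eps_bound \<rho> lam \<delta> m \<zeta> y / m)"
    by (intro sum_mono expectation_rej_max_le m0 \<zeta> \<delta> y) auto
  also have "\<dots> = FDR_FM m m0 lam level (\<lambda>_. 1) + real m0 / m * eps_bound \<rho> lam \<delta> m \<zeta> y"
    by (simp add: sum.distrib FDR_FM_one[OF m0])
  finally show ?thesis .
qed

lemma FDR_FM_bounds:
  assumes F: "F \<in> cdf_class" and m0: "m0 \<le> m"
  shows "0 \<le> FDR_FM m m0 lam level F" "FDR_FM m m0 lam level F \<le> 1"
proof -
  interpret real_product "{..<m}" "\<lambda>i. if i < m0 then unif else law F" by (rule real_product_FM[OF F])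
  show "0 \<le> FDR_FM m m0 lam level F"
    unfolding FDR_FM_eq_sum[OF F m0]
    by (intro sum_nonneg Bochner_Integration.integral_nonneg rej_nonneg)
  have le: "FDP m m0 lam level p \<le> 1" for p
  proof -
    have "card {i. i < m0 \<and> p i \<le> c} \<le> card {i. i < m \<and> p i \<le> c}" for c
      using m0 by (intro card_mono) auto
    then show ?thesis unfolding FDP_def Let_def by (simp add: divide_le_eq_1 le_max_iff_disj)
  qed
  have "E (\<lambda>p. FDP m m0 lam level p) \<le> E (\<lambda>_. 1 :: real)"
  proof (rule expectation_mono_det[OF _ _ finite_levels order_refl le])
    show "determined_by {..<m} levels (\<lambda>p. FDP m m0 lam level p)"
      unfolding FDP_eq_sum_rej[OF m0] by (intro determined_by_sum det_rej) (use m0 in auto)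
  qed (simp add: determined_by_def)
  then show "FDR_FM m m0 lam level F \<le> 1"
    by (simp add: FDR_FM_def FM_def P.prob_space)
qed

lemma eps_bound_nonneg:
  assumes "0 < \<zeta>" "\<zeta> < 1" "0 < \<delta>"
  shows "0 \<le> eps_bound \<rho> lam \<delta> m \<zeta> y"
proof -
  have "u_minus \<rho> m lam \<zeta> \<delta> \<le> u_plus \<rho> m lam \<zeta> \<delta>" "0 \<le> u_minus \<rho> m lam \<zeta> \<delta>"
    "0 \<le> u_plus \<rho> m lam \<zeta> \<delta>" "u_plus \<rho> m lam \<zeta> \<delta> \<le> 1"
    using u_plus_bounds[of \<zeta> \<delta>] u_minus_bounds[of \<zeta> \<delta>] u_minus_le_u_plus[of \<zeta> \<delta>] assms by auto
  then have "0 \<le> (\<rho> (u_plus \<rho> m lam \<zeta> \<delta>) - \<rho> (u_minus \<rho> m lam \<zeta> \<delta>)) / u_plus \<rho> m lam \<zeta> \<delta>"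
    using rho_monoD[of "u_minus \<rho> m lam \<zeta> \<delta>" "u_plus \<rho> m lam \<zeta> \<delta>"] by simp
  then show ?thesis
    unfolding eps_bound_def using assms by (intro add_nonneg_nonneg mult_nonneg_nonneg) auto
qed

lemma FDR_RM_le:
  assumes F: "F \<in> cdf_class" and \<zeta>: "0 < \<zeta>" "\<zeta> < 1" and \<delta>: "0 < \<delta>"
  shows "FDR_RM m \<zeta> lam level F \<le> FDR_RM m \<zeta> lam level (\<lambda>_. 1)
    + \<zeta> * eps_bound \<rho> lam \<delta> m \<zeta> \<gamma> + 2 * exp (- 2 * real m * (max 0 (\<gamma> - 1 / real m))\<^sup>2)"
proof -
  let ?b = "\<lambda>k. real (m choose k) * \<zeta> ^ k * (1 - \<zeta>) ^ (m - k)"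
  let ?e = "eps_bound \<rho> lam \<delta> m \<zeta> \<gamma>" and ?\<eta> = "max 0 (\<gamma> - 1 / real m)"
  let ?S = "{k. ?\<eta> \<le> \<bar>real k / m - \<zeta>\<bar>}"
  have D: "FDR_FM m k lam level F \<le> FDR_FM m k lam level (\<lambda>_. 1) + real k / m * ?e + of_bool (k \<in> ?S)"
    if k: "k \<le> m" for k
  proof (cases "\<bar>(real k - 1) / m - \<zeta>\<bar> \<le> \<gamma>")
    case True
    show ?thesis using FDR_FM_le[OF F k \<zeta> \<delta> True] by simp
  next
    case False
    have "(real k - 1) / m = real k / m - 1 / m" by (rule diff_divide_distrib)
    moreover have "0 < 1 / real m" using m_pos by simp
    ultimately have "\<gamma> - 1 / m \<le> \<bar>real k / m - \<zeta>\<bar>" using False by linarith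
    then have "k \<in> ?S" by simp
    moreover have "0 \<le> real k / m * ?e" using eps_bound_nonneg[OF \<zeta> \<delta>] by simp
    ultimately show ?thesis
      using FDR_FM_bounds(2)[OF F k] FDR_FM_bounds(1)[OF one_cdf_class k] by simp
  qed
  have "FDR_RM m \<zeta> lam level F \<le>
      (\<Sum>k\<le>m. ?b k * (FDR_FM m k lam level (\<lambda>_. 1) + real k / m * ?e + of_bool (k \<in> ?S)))"
    unfolding FDR_RM_def using \<zeta> by (intro sum_mono mult_left_mono D) auto
  also have "\<dots> = FDR_RM m \<zeta> lam level (\<lambda>_. 1) + (\<Sum>k\<le>m. real k * Bernstein m k \<zeta>) / m * ?e
      + (\<Sum>k\<le>m. ?b k * of_bool (k \<in> ?S))"
    unfolding FDR_RM_def Bernstein_def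
    by (simp add: distrib_left sum.distrib sum_distrib_left sum_distrib_right sum_divide_distrib mult_ac)
  also have "(\<Sum>k\<le>m. real k * Bernstein m k \<zeta>) / m = \<zeta>"
    using m_pos by (simp add: sum_k_Bernstein)
  also have "(\<Sum>k\<le>m. ?b k * of_bool (k \<in> ?S)) \<le> 2 * exp (- 2 * real m * ?\<eta>\<^sup>2)"
  proof -
    interpret binomial_distribution m \<zeta> by unfold_locales (use \<zeta> in auto)
    have "(\<Sum>k\<le>m. ?b k * of_bool (k \<in> ?S)) = (\<Sum>k\<in>{..m} \<inter> ?S. pmf (binomial_pmf m \<zeta>) k)"
      using \<zeta> by (auto simp: of_bool_def sum.inter_restrict intro!: sum.cong)
    also have "\<dots> = measure_pmf.prob (binomial_pmf m \<zeta>) ({..m} \<inter> ?S)"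
      by (rule measure_measure_pmf_finite[symmetric]) simp
    also have "\<dots> \<le> measure_pmf.prob (binomial_pmf m \<zeta>) ?S"
      by (rule measure_pmf.finite_measure_mono) auto
    also have "\<dots> \<le> 2 * exp (- 2 * real m * ?\<eta>\<^sup>2)"
      using prob_abs_ge'[of ?\<eta>] m_pos by simp
    finally show ?thesis .
  qed
  finally show ?thesis by simp
qed

end

theorem theorem4p2:
  fixes m lam :: nat and \<rho> :: "real \<Rightarrow> real" and t :: "nat \<Rightarrow> real"
    and \<zeta> \<delta> :: real and F :: "real \<Rightarrow> real"
  assumes m: "m \<ge> 2"
    and rho_cont: "continuous_on {0..1} \<rho>"
    and rho_mono: "mono_on {0..1} \<rho>"
    and rho_range: "\<rho> ` {0..1} \<subseteq> {0..1}"
    and rho_ratio: "mono_on {0<..1} (\<lambda>x. \<rho> x / x)"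
    and t_def: "\<forall>k. t k = \<rho> (real k / real m)"
    and zeta: "0 < \<zeta>" "\<zeta> < 1"
    and lam: "lam \<in> {1..m}"
    and delta: "0 < \<delta>" "\<delta> < 1"
    and F: "F \<in> cdf_class"
  shows "(\<forall>m0. 0 < m0 \<and> m0 < m \<longrightarrow>
            FDR_FM m m0 lam t F \<le> FDR_FM m m0 lam t (\<lambda>_. 1)
              + real m0 / real m *
                eps_bound \<rho> lam \<delta> m \<zeta>
                  (max \<bar>(real m0 - 1) / real m - \<zeta>\<bar> \<bar>real m0 / real m - \<zeta>\<bar>))
       \<and> (\<forall>\<gamma>. 0 < \<gamma> \<and> \<gamma> < 1 \<longrightarrow>
            FDR_RM m \<zeta> lam t F \<le> FDR_RM m \<zeta> lam t (\<lambda>_. 1)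
              + \<zeta> * eps_bound \<rho> lam \<delta> m \<zeta> \<gamma>
              + 4 * exp (- 2 * real m * (max 0 (\<gamma> - 1 / real m))\<^sup>2))"
proof -
  interpret sud_setup m lam \<rho>
    by unfold_locales (fact rho_cont rho_mono rho_range rho_ratio lam)+
  have t: "t = level" using t_def by auto
  show ?thesis
    unfolding t
  proof (intro conjI allI impI)
    fix m0 :: nat assume "0 < m0 \<and> m0 < m"
    then show "FDR_FM m m0 lam level F \<le> FDR_FM m m0 lam level (\<lambda>_. 1) + real m0 / real m *
        eps_bound \<rho> lam \<delta> m \<zeta> (max \<bar>(real m0 - 1) / real m - \<zeta>\<bar> \<bar>real m0 / real m - \<zeta>\<bar>)"
      by (intro FDR_FM_le F zeta delta) auto
  next
    fix \<gamma> :: real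
    have "(0::real) \<le> exp (- 2 * real m * (max 0 (\<gamma> - 1 / real m))\<^sup>2)" by simp
    then show "FDR_RM m \<zeta> lam level F \<le> FDR_RM m \<zeta> lam level (\<lambda>_. 1)
        + \<zeta> * eps_bound \<rho> lam \<delta> m \<zeta> \<gamma> + 4 * exp (- 2 * real m * (max 0 (\<gamma> - 1 / real m))\<^sup>2)"
      using FDR_RM_le[OF F zeta delta(1), of \<gamma>] by linarith
  qed
qed

end
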